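(* For every positive integer $\ell$, every graph $G$ and every $S\subseteq V(G)$: if $G$ has no $S$-rooted model of $P_\ell$, then $\operatorname{td}(G,S)\leq \binom{\ell}{2}$.
   Context: Graphs are finite and simple; the null graph is allowed (and is a rooted forest). $P_\ell$ is the path on $\ell$ vertices. A model of $H$ in $G$ is a family $(B_x\mid x\in V(H))$ of pairwise disjoint subsets of $V(G)$ such that each $G[B_x]$ is non-empty and connected and for every edge $xy\in E(H)$ there is an edge of $G$ between $B_x$ and $B_y$; it is $S$-rooted if $B_x\cap S\neq\emptyset$ for every $x\in V(H)$. For a rooted forest $F$, its closure is the graph on $V(F)$ where distinct $v,w$ are adjacent iff one is an ancestor of the other; $F$ is an elimination forest of a graph $H$ if $V(F)=V(H)$ and $H$ is a subgraph of the closure of $F$. The vertex-height of $F$ is the maximum number of vertices on a root-to-leaf path (0 for the null forest). An elimination forest of $(G,S)$ is an elimination forest $F$ of some induced subgraph $H$ of $G$ with $S\subseteq V(H)$ such that for every component $C$ of $G-V(H)$, either $V(C)$ has no neighbours in $G$ or some root-to-leaf path of $F$ contains all neighbours of $V(C)$ in $G$. $\operatorname{td}(G,S)$ is the minimum vertex-height of an elimination forest of $(G,S)$. *)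

theory Defs
  imports
    "Graph_Theory.Digraph_Component"
    "Graph_Theory.Vertex_Walk"
    "HOL-Library.Disjoint_Sets"
begin

text \<open>
  A finite simple graph is a \<^locale>\<open>pair_graph\<close>: a finite, symmetric, loop-free set of pairs.
  The null graph is allowed, but \<^const>\<open>connected\<close> implies that the vertex set is non-empty.
\<close>

definition path_graph :: "nat \<Rightarrow> nat pair_pre_digraph" where
  "path_graph l = \<lparr> pverts = {..<l}, parcs = {(i, j). i < l \<and> j < l \<and> (j = Suc i \<or> i = Suc j)} \<rparr>"

definition neighbours :: "'a pair_pre_digraph \<Rightarrow> 'a set \<Rightarrow> 'a set" where
  "neighbours G X = {v \<in> pverts G - X. \<exists>u\<in>X. (u, v) \<in> parcs G}"

definition is_model :: "'h pair_pre_digraph \<Rightarrow> 'a pair_pre_digraph \<Rightarrow> ('h \<Rightarrow> 'a set) \<Rightarrow> bool" where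
  "is_model H G B \<longleftrightarrow>
     (\<forall>x\<in>pverts H. B x \<subseteq> pverts G \<and> connected (G \<restriction> B x)) \<and>
     disjoint_family_on B (pverts H) \<and>
     (\<forall>(x, y)\<in>parcs H. \<exists>u\<in>B x. \<exists>v\<in>B y. (u, v) \<in> parcs G)"

definition is_rooted_model ::
  "'h pair_pre_digraph \<Rightarrow> 'a pair_pre_digraph \<Rightarrow> 'a set \<Rightarrow> ('h \<Rightarrow> 'a set) \<Rightarrow> bool" where
  "is_rooted_model H G S B \<longleftrightarrow> is_model H G B \<and> (\<forall>x\<in>pverts H. B x \<inter> S \<noteq> {})"

text \<open>
  A rooted forest is encoded by its parent-to-child arcs. Roots are the vertices of in-degree 0,
  leaves those of out-degree 0 (so an isolated vertex is both), and \<open>v\<close> is an ancestor of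
  \<open>w\<close> iff \<open>w\<close> is reachable from \<open>v\<close>.
\<close>

definition rooted_forest :: "'a pair_pre_digraph \<Rightarrow> bool" where
  "rooted_forest F \<longleftrightarrow>
     pair_fin_digraph F \<and> acyclic (parcs F) \<and> (\<forall>v\<in>pverts F. in_degree F v \<le> 1)"

definition forest_closure :: "'a pair_pre_digraph \<Rightarrow> 'a pair_pre_digraph" where
  "forest_closure F =
     \<lparr> pverts = pverts F, parcs = {(v, w). v \<noteq> w \<and> (v \<rightarrow>\<^sup>*\<^bsub>F\<^esub> w \<or> w \<rightarrow>\<^sup>*\<^bsub>F\<^esub> v)} \<rparr>"

definition root_to_leaf_path :: "'a pair_pre_digraph \<Rightarrow> 'a vwalk \<Rightarrow> bool" where
  "root_to_leaf_path F p \<longleftrightarrow> vpath p F \<and> in_degree F (hd p) = 0 \<and> out_degree F (last p) = 0"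

definition vertex_height :: "'a pair_pre_digraph \<Rightarrow> nat" where
  "vertex_height F = Max (insert 0 (length ` {p. root_to_leaf_path F p}))"

definition elimination_forest ::
  "'a pair_pre_digraph \<Rightarrow> ('a, 'a \<times> 'a) pre_digraph \<Rightarrow> bool" where
  "elimination_forest F H \<longleftrightarrow>
     rooted_forest F \<and> pverts F = verts H \<and> subgraph H (forest_closure F)"

definition component :: "('a, 'b) pre_digraph \<Rightarrow> ('a, 'b) pre_digraph \<Rightarrow> bool" where
  "component C G \<longleftrightarrow> pre_digraph.max_subgraph G connected C"

definition rel_elimination_forest ::
  "'a pair_pre_digraph \<Rightarrow> 'a pair_pre_digraph \<Rightarrow> 'a set \<Rightarrow> bool" where
  "rel_elimination_forest F G S \<longleftrightarrow>
     (\<exists>H. induced_subgraph H G \<and> S \<subseteq> verts H \<and> elimination_forest F H \<and>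
       (\<forall>C. component C (G \<restriction> (pverts G - verts H)) \<longrightarrow>
          neighbours G (verts C) = {} \<or>
          (\<exists>p. root_to_leaf_path F p \<and> neighbours G (verts C) \<subseteq> set p)))"

text \<open>
  The minimum is over a non-empty set when \<open>G\<close> is finite and \<open>S \<subseteq> pverts G\<close>: any linear order
  of \<open>pverts G\<close> is an elimination forest of \<open>(G, S)\<close>.
\<close>

definition td :: "'a pair_pre_digraph \<Rightarrow> 'a set \<Rightarrow> nat" where
  "td G S = (LEAST h. \<exists>F. rel_elimination_forest F G S \<and> vertex_height F = h)"

end

theory Submission
  imports Defs "HOL-Library.Sublist"
begin

text \<open>
  Induct on \<open>l\<close>, treating the components of \<open>G\<close> separately. In a connected \<open>G\<close> without rooted
  model of \<open>P\<^sub>l\<close>, any two rooted models of \<open>P\<^sub>l\<^sub>-\<^sub>1\<close> intersect: two disjoint ones could be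
  joined by a bridge between their longer halves. Pairwise intersecting connected sets are all hit
  by a single path \<open>p\<close>, obtained by walking greedily into the component that still contains a
  model. If there were \<open>l\<close> disjoint paths from \<open>p\<close> to \<open>S\<close>, cutting \<open>p\<close> into \<open>l\<close> segments would
  give a rooted model of \<open>P\<^sub>l\<close>; so by Menger's theorem at most \<open>l - 1\<close> vertices \<open>X\<close> separate
  \<open>p\<close> from \<open>S\<close>. A rooted model of \<open>P\<^sub>l\<^sub>-\<^sub>1\<close> avoiding \<open>X\<close> meets \<open>S\<close>, hence misses \<open>p\<close>, which is
  impossible. Placing \<open>X\<close> as a chain above an elimination forest of \<open>G - X\<close> gives the bound
  \<open>(l - 1) + (l - 1 choose 2) = l choose 2\<close>.
\<close>

section \<open>Connected sets and Menger's theorem\<close>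

text \<open>
  For symmetric \<open>E\<close>, this is connectedness of the subgraph induced by \<open>C\<close>; in general it is
  strong connectedness.
\<close>

definition conn :: "'a rel \<Rightarrow> 'a set \<Rightarrow> bool" where
  "conn E C \<longleftrightarrow> C \<noteq> {} \<and> (\<forall>D\<subseteq>C. D \<noteq> {} \<longrightarrow> E `` D \<inter> C \<subseteq> D \<longrightarrow> D = C)"

text \<open>Serves as an induction principle: a property that holds somewhere in \<open>C\<close>
  and spreads along the edges inside \<open>C\<close> holds on all of \<open>C\<close>. As
  \<open>D\<close> may stick out of \<open>C\<close>, it can be a set such as everything reachable
  from a given vertex.\<close>

lemma conn_closedD:
  assumes "conn E C" "D \<inter> C \<noteq> {}" "\<And>u v. u \<in> D \<Longrightarrow> u \<in> C \<Longrightarrow> v \<in> C \<Longrightarrow> (u, v) \<in> E \<Longrightarrow> v \<in> D"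
  shows "C \<subseteq> D"
proof -
  have "E `` (D \<inter> C) \<inter> C \<subseteq> D \<inter> C" using assms(3) by blast
  moreover have "D \<inter> C \<subseteq> C" by blast
  ultimately have "D \<inter> C = C" using assms(1,2) unfolding conn_def by simp
  then show ?thesis by blast
qed

lemma conn_crossing:
  assumes "conn E C" "a \<in> C" "a \<in> D" "b \<in> C" "b \<notin> D"
  obtains u v where "u \<in> C" "u \<in> D" "v \<in> C" "v \<notin> D" "(u, v) \<in> E"
  using conn_closedD[OF assms(1), of D] assms(2-5) that by blast

lemma connI:
  assumes "C \<noteq> {}"
    and "\<And>D w. D \<subseteq> C \<Longrightarrow> w \<in> D \<Longrightarrow>
      (\<And>u v. u \<in> D \<Longrightarrow> v \<in> C \<Longrightarrow> (u, v) \<in> E \<Longrightarrow> v \<in> D) \<Longrightarrow> C \<subseteq> D"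
  shows "conn E C"
  unfolding conn_def
proof (intro conjI allI impI)
  fix D assume D: "D \<subseteq> C" "D \<noteq> {}" "E `` D \<inter> C \<subseteq> D"
  then obtain w where "w \<in> D" by blast
  then have "C \<subseteq> D" using assms(2)[of D w] D by blast
  with D show "D = C" by blast
qed (fact assms(1))

lemma conn_nonempty: "conn E C \<Longrightarrow> C \<noteq> {}"
  by (simp add: conn_def)

lemma conn_singleton: "conn E {v}"
  unfolding conn_def by blast

lemma conn_Union:
  assumes "\<C> \<noteq> {}" "\<And>C. C \<in> \<C> \<Longrightarrow> conn E C \<and> v \<in> C"
  shows "conn E (\<Union>\<C>)"
proof (rule connI)
  show "\<Union>\<C> \<noteq> {}" using assms by blast
next
  fix D w assume D: "D \<subseteq> \<Union>\<C>" "w \<in> D"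
    and cl: "\<And>u v. u \<in> D \<Longrightarrow> v \<in> \<Union>\<C> \<Longrightarrow> (u, v) \<in> E \<Longrightarrow> v \<in> D"
  have sub: "C \<subseteq> D" if "C \<in> \<C>" "D \<inter> C \<noteq> {}" for C
    using conn_closedD[of E C D] assms(2) that cl by blast
  from D obtain C where "C \<in> \<C>" "w \<in> C" by blast
  then have "v \<in> D" using sub[of C] assms(2) D by blast
  then show "\<Union>\<C> \<subseteq> D" using sub assms(2) by blast
qed

lemma conn_Un:
  assumes "conn E C" "conn E D" "v \<in> C" "v \<in> D"
  shows "conn E (C \<union> D)"
  using conn_Union[of "{C, D}" E v] assms by auto

lemma conn_edge:
  assumes "sym E" "(u, v) \<in> E"
  shows "conn E {u, v}"
  using assms by (intro connI) (auto dest: symD)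

lemma conn_Un_adj:
  assumes "sym E" "conn E C" "conn E D" "u \<in> C" "v \<in> D" "(u, v) \<in> E"
  shows "conn E (C \<union> D)"
proof -
  have "conn E (C \<union> {u, v})"
    using conn_Un assms conn_edge by (metis insertI1)
  then have "conn E ((C \<union> {u, v}) \<union> D)"
    using conn_Un[of E "C \<union> {u, v}" D v] assms by blast
  moreover have "(C \<union> {u, v}) \<union> D = C \<union> D" using assms by blast
  ultimately show ?thesis by simp
qed

lemma conn_insert:
  assumes "sym E" "conn E C" "u \<in> C" "(u, v) \<in> E"
  shows "conn E (insert v C)"
  using conn_Un_adj[OF assms(1,2) conn_singleton assms(3) _ assms(4)] by simp

lemma conn_mono:
  assumes "conn E C" "\<And>u v. u \<in> C \<Longrightarrow> v \<in> C \<Longrightarrow> (u, v) \<in> E \<Longrightarrow> (u, v) \<in> E'"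
  shows "conn E' C"
proof (rule connI)
  show "C \<noteq> {}" using assms conn_nonempty by blast
next
  fix D w assume "D \<subseteq> C" "w \<in> D" "\<And>u v. u \<in> D \<Longrightarrow> v \<in> C \<Longrightarrow> (u, v) \<in> E' \<Longrightarrow> v \<in> D"
  then show "C \<subseteq> D" using assms by (intro conn_closedD[of E]) blast+
qed

section \<open>Components and first hits of a vertex set\<close>

definition comp_of :: "'a rel \<Rightarrow> 'a set \<Rightarrow> 'a \<Rightarrow> 'a set" where
  "comp_of E V v = \<Union>{C. conn E C \<and> v \<in> C \<and> C \<subseteq> V}"

lemma comp_of_subset: "comp_of E V v \<subseteq> V"
  unfolding comp_of_def by blast

lemma comp_of_self: "v \<in> V \<Longrightarrow> v \<in> comp_of E V v"
  unfolding comp_of_def using conn_singleton[of E v] by blast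

lemma conn_comp_of: "v \<in> V \<Longrightarrow> conn E (comp_of E V v)"
  unfolding comp_of_def using conn_singleton[of E v] by (intro conn_Union[where v = v]) auto

lemma conn_subset_comp_of:
  assumes "v \<in> V" "conn E C" "C \<subseteq> V" "C \<inter> comp_of E V v \<noteq> {}"
  shows "C \<subseteq> comp_of E V v"
proof -
  obtain w where w: "w \<in> C" "w \<in> comp_of E V v" using assms(4) by blast
  have "conn E (C \<union> comp_of E V v)"
    using conn_Un[OF assms(2) conn_comp_of[OF assms(1)] w] .
  moreover have "v \<in> C \<union> comp_of E V v" "C \<union> comp_of E V v \<subseteq> V"
    using comp_of_self[OF assms(1)] comp_of_subset[of E V v] assms(3) by blast+
  ultimately have "C \<union> comp_of E V v \<in> {D. conn E D \<and> v \<in> D \<and> D \<subseteq> V}" by simp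
  then have "C \<union> comp_of E V v \<subseteq> comp_of E V v" unfolding comp_of_def[of E V v] by (rule Union_upper)
  then show ?thesis by blast
qed

lemma comp_of_cong:
  assumes "v \<in> V" "w \<in> comp_of E V v"
  shows "comp_of E V w = comp_of E V v"
proof
  have w: "w \<in> V" using assms(2) comp_of_subset by (rule rev_subsetD)
  note w_self = comp_of_self[OF w, of E]
  show sub: "comp_of E V w \<subseteq> comp_of E V v"
    using conn_subset_comp_of[OF assms(1) conn_comp_of[OF w] comp_of_subset] w_self assms(2) by blast
  show "comp_of E V v \<subseteq> comp_of E V w"
    using conn_subset_comp_of[OF w conn_comp_of[OF assms(1)] comp_of_subset] w_self assms(2) by blast
qed

text \<open>An edge leaves the component of \<open>m\<close> in \<open>R - N\<close>, because
  \<open>R\<close> is connected and meets \<open>N\<close>. Its outer end lies in \<open>N\<close>,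
  as otherwise it could be added to the component.\<close>

lemma conn_first_hit:
  assumes "sym E" "conn E R" "m \<in> R" "m \<notin> N" "R \<inter> N \<noteq> {}"
  obtains D d n where "conn E D" "m \<in> D" "D \<subseteq> R" "D \<inter> N = {}" "d \<in> D" "n \<in> R" "n \<in> N" "(d, n) \<in> E"
proof -
  let ?D = "comp_of E (R - N) m"
  have m: "m \<in> R - N" using assms by blast
  obtain b where b: "b \<in> R" "b \<in> N" using assms by blast
  with comp_of_subset[of E "R - N" m] have "b \<notin> ?D" by blast
  with conn_crossing[OF assms(2,3) comp_of_self[OF m] b(1)]
  obtain u v where uv: "u \<in> R" "u \<in> ?D" "v \<in> R" "v \<notin> ?D" "(u, v) \<in> E" by metis
  have "v \<in> N"
  proof (rule ccontr)
    assume "v \<notin> N"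
    then have "insert v ?D \<subseteq> ?D"
      using conn_subset_comp_of[OF m conn_insert[OF assms(1) conn_comp_of[OF m] uv(2,5)]]
        uv comp_of_subset[of E "R - N" m] by blast
    with uv show False by blast
  qed
  with that[of ?D u v] show ?thesis
    using conn_comp_of[OF m] comp_of_self[OF m] comp_of_subset[of E "R - N" m] uv by blast
qed

text \<open>Plays the role of following a path from \<open>a\<close> and stopping at its first
  vertex \<open>z\<close> in \<open>Y\<close>. The final disjunction records that everything before
  \<open>z\<close> is joined to \<open>a\<close> without touching \<open>Y\<close>.\<close>

lemma conn_trim:
  assumes "sym E" "conn E R" "a \<in> R" "R \<inter> Y \<noteq> {}"
  obtains T z where "conn E T" "T \<subseteq> R" "a \<in> T" "z \<in> R" "T \<inter> Y = {z}"
    "T = {z} \<or> (\<exists>D. T = insert z D \<and> conn E D \<and> a \<in> D \<and> D \<inter> Y = {})"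
proof (cases "a \<in> Y")
  case True
  show ?thesis by (rule that[of "{a}" a]) (use True assms in \<open>auto simp: conn_singleton\<close>)
next
  case False
  from conn_first_hit[OF assms(1-3) False assms(4)]
  obtain D d n where D: "conn E D" "a \<in> D" "D \<subseteq> R" "D \<inter> Y = {}" "d \<in> D" "n \<in> R" "n \<in> Y" "(d, n) \<in> E" .
  have "conn E (insert n D)" using conn_insert D assms(1) by metis
  then show ?thesis by (rule that[of _ n]) (use D in blast)+
qed

section \<open>Separators, linkages and Menger's theorem\<close>

definition separates :: "'a rel \<Rightarrow> 'a set \<Rightarrow> 'a set \<Rightarrow> 'a set \<Rightarrow> bool" where
  "separates E A S X \<longleftrightarrow>
     (\<forall>C. conn E C \<longrightarrow> C \<inter> A \<noteq> {} \<longrightarrow> C \<inter> S \<noteq> {} \<longrightarrow> C \<inter> X \<noteq> {})"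

text \<open>
  Disjoint connected sets take the place of the disjoint paths in Menger's theorem.
\<close>

definition linked :: "'a rel \<Rightarrow> 'a set \<Rightarrow> 'a set \<Rightarrow> nat \<Rightarrow> bool" where
  "linked E A S k \<longleftrightarrow>
     (\<exists>\<P>. finite \<P> \<and> card \<P> = k \<and> pairwise disjnt \<P> \<and>
       (\<forall>P\<in>\<P>. conn E P \<and> P \<inter> A \<noteq> {} \<and> P \<inter> S \<noteq> {}))"

text \<open>For symmetric \<open>E\<close>, these are the vertices reachable from \<open>A\<close>
  after the removal of \<open>Y\<close>.\<close>

definition side :: "'a rel \<Rightarrow> 'a set \<Rightarrow> 'a set \<Rightarrow> 'a set" where
  "side E A Y = \<Union>{C. conn E C \<and> C \<inter> A \<noteq> {} \<and> C \<inter> Y = {}}"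

lemma separates_commute: "separates E A S X \<longleftrightarrow> separates E S A X"
  unfolding separates_def by blast

lemma sideI: "conn E C \<Longrightarrow> C \<inter> A \<noteq> {} \<Longrightarrow> C \<inter> Y = {} \<Longrightarrow> v \<in> C \<Longrightarrow> v \<in> side E A Y"
  unfolding side_def by blast

lemma sideE:
  assumes "v \<in> side E A Y"
  obtains C where "conn E C" "C \<inter> A \<noteq> {}" "C \<inter> Y = {}" "v \<in> C"
  using assms unfolding side_def by blast

lemma side_base: "a \<in> A \<Longrightarrow> a \<notin> Y \<Longrightarrow> a \<in> side E A Y"
  by (rule sideI[OF conn_singleton]) auto

lemma side_disjoint: "side E A Y \<inter> Y = {}"
  unfolding side_def by blast

lemma side_antimono: "Y \<subseteq> Z \<Longrightarrow> side E A Z \<subseteq> side E A Y"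
  unfolding side_def by blast

lemma side_step:
  assumes "sym E" "u \<in> side E A Y" "(u, v) \<in> E" "v \<notin> Y"
  shows "v \<in> side E A Y"
proof -
  obtain C where "conn E C" "C \<inter> A \<noteq> {}" "C \<inter> Y = {}" "u \<in> C" using assms(2) by (rule sideE)
  then show ?thesis using assms
    by (intro sideI[of E "insert v C"] conn_insert) blast+
qed

lemma sides_disjoint:
  assumes "separates E A S Y"
  shows "side E A Y \<inter> side E S Y = {}"
proof (rule ccontr)
  assume "\<not> ?thesis"
  then obtain w where w: "w \<in> side E A Y" "w \<in> side E S Y" by blast
  obtain C where C: "conn E C" "C \<inter> A \<noteq> {}" "C \<inter> Y = {}" "w \<in> C" using w(1) by (rule sideE)
  obtain D where D: "conn E D" "D \<inter> S \<noteq> {}" "D \<inter> Y = {}" "w \<in> D" using w(2) by (rule sideE)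
  have "conn E (C \<union> D)" using conn_Un C D by metis
  then show False using assms C D unfolding separates_def by blast
qed

text \<open>Trim each of the \<open>k\<close> sets at its first vertex in \<open>Y\<close>. These
  end vertices are distinct and \<open>Y\<close> has at most \<open>k\<close> elements, so they
  exhaust \<open>Y\<close> and can serve as indices of the trimmed sets.\<close>

lemma linked_onto:
  assumes "sym E" "linked E A Y k" "finite Y" "card Y \<le> k"
  obtains P where "\<And>z. z \<in> Y \<Longrightarrow> conn E (P z)" "\<And>z. z \<in> Y \<Longrightarrow> P z \<inter> A \<noteq> {}"
    "\<And>z. z \<in> Y \<Longrightarrow> P z \<inter> Y = {z}" "\<And>z. z \<in> Y \<Longrightarrow> P z \<subseteq> insert z (side E A Y)"
    "disjoint_family_on P Y" "card Y = k"
proof -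
  obtain \<P> where \<P>: "finite \<P>" "card \<P> = k" "pairwise disjnt \<P>"
    and R: "\<And>R. R \<in> \<P> \<Longrightarrow> conn E R \<and> R \<inter> A \<noteq> {} \<and> R \<inter> Y \<noteq> {}"
    using assms(2) unfolding linked_def by blast
  have "\<exists>T z. conn E T \<and> T \<subseteq> R \<and> T \<inter> A \<noteq> {} \<and> z \<in> R \<and> T \<inter> Y = {z} \<and> T \<subseteq> insert z (side E A Y)"
    if RP: "R \<in> \<P>" for R
  proof -
    obtain a where a: "a \<in> R" "a \<in> A" using R[OF RP] by blast
    obtain T z where T: "conn E T" "T \<subseteq> R" "a \<in> T" "z \<in> R" "T \<inter> Y = {z}"
      and D: "T = {z} \<or> (\<exists>D. T = insert z D \<and> conn E D \<and> a \<in> D \<and> D \<inter> Y = {})"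
      using conn_trim[OF assms(1) _ a(1)] R[OF RP] by metis
    have "T \<subseteq> insert z (side E A Y)"
      using D a(2) by (auto intro: sideI)
    with T a show ?thesis by blast
  qed
  then obtain T g where T: "\<And>R. R \<in> \<P> \<Longrightarrow> conn E (T R) \<and> T R \<subseteq> R \<and> T R \<inter> A \<noteq> {} \<and> g R \<in> R
      \<and> T R \<inter> Y = {g R} \<and> T R \<subseteq> insert (g R) (side E A Y)"
    by metis
  have inj: "inj_on g \<P>"
    using T \<P>(3) by (intro inj_onI) (metis disjnt_iff pairwiseD)
  have "g ` \<P> \<subseteq> Y" using T by blast
  then have img: "g ` \<P> = Y"
    using card_image[OF inj] \<P>(2) assms(3,4) by (intro card_seteq) auto
  define P where "P z = T (the_inv_into \<P> g z)" for z
  have inv: "the_inv_into \<P> g z \<in> \<P>" "g (the_inv_into \<P> g z) = z" if "z \<in> Y" for z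
    using that img the_inv_into_into[OF inj, of z \<P>] f_the_inv_into_f[OF inj, of z] by auto
  show ?thesis
  proof
    fix z assume "z \<in> Y"
    note z = inv[OF this] T[OF inv(1)[OF this]]
    show "conn E (P z)" "P z \<inter> A \<noteq> {}" "P z \<inter> Y = {z}" "P z \<subseteq> insert z (side E A Y)"
      using z unfolding P_def by auto
  next
    show "disjoint_family_on P Y"
      unfolding disjoint_family_on_def
    proof (intro ballI impI)
      fix z w assume zw: "z \<in> Y" "w \<in> Y" "z \<noteq> w"
      then have "the_inv_into \<P> g z \<noteq> the_inv_into \<P> g w" using inv by metis
      then have "disjnt (the_inv_into \<P> g z) (the_inv_into \<P> g w)"
        using \<P>(3) inv zw by (meson pairwiseD)
      then show "P z \<inter> P w = {}"
        using T[OF inv(1)[OF zw(1)]] T[OF inv(1)[OF zw(2)]] unfolding P_def disjnt_def by blast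
    qed
  next
    show "card Y = k" using img card_image[OF inj] \<P>(2) by simp
  qed
qed

lemma linkedI:
  assumes "finite I" "card I = k" "disjoint_family_on P I"
    "\<And>i. i \<in> I \<Longrightarrow> conn E (P i) \<and> P i \<inter> A \<noteq> {} \<and> P i \<inter> S \<noteq> {}"
  shows "linked E A S k"
proof -
  have "inj_on P I"
    using assms(3,4) conn_nonempty unfolding disjoint_family_on_def inj_on_def by (metis Int_absorb)
  moreover have "pairwise disjnt (P ` I)"
    using assms(3) unfolding disjoint_family_on_def pairwise_def disjnt_def by (metis imageE)
  ultimately show ?thesis
    unfolding linked_def using assms by (intro exI[of _ "P ` I"]) (auto simp: card_image)
qed

text \<open>Suppose a connected \<open>C\<close> avoiding \<open>Z\<close> joins \<open>a\<close> in
  \<open>A\<close> to \<open>s\<close> in \<open>S\<close>. The component \<open>?R\<close> of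
  \<open>a\<close> in \<open>C\<close> without the edge \<open>xy\<close> misses \<open>x\<close>
  and \<open>Y\<close> by the choice of \<open>Z\<close>, and misses \<open>y\<close>, which is on
  the \<open>S\<close>-side. So restoring the edge does not enlarge \<open>?R\<close>; hence
  \<open>?R\<close> contains \<open>s\<close>, which then lies on both sides of
  \<open>Y\<close>.\<close>

lemma separates_insert_end:
  assumes "sym E" "separates (E - {(x, y), (y, x)}) A S Y"
    and x: "x \<in> side (E - {(x, y), (y, x)}) A Y" and y: "y \<in> side (E - {(x, y), (y, x)}) S Y"
    and sep: "separates (E - {(x, y), (y, x)}) A (insert x Y) Z"
  shows "separates E A S Z"
  unfolding separates_def
proof (intro allI impI notI)
  let ?E = "E - {(x, y), (y, x)}"
  have sym': "sym ?E" using assms(1) unfolding sym_def by blast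
  have disj: "side ?E A Y \<inter> side ?E S Y = {}" using sides_disjoint assms(2) .
  fix C assume C: "conn E C" "C \<inter> A \<noteq> {}" "C \<inter> S \<noteq> {}" "C \<inter> Z = {}"
  then obtain a s where a: "a \<in> C" "a \<in> A" and s: "s \<in> C" "s \<in> S" by blast
  let ?R = "comp_of ?E C a"
  have R: "conn ?E ?R" "a \<in> ?R" "?R \<subseteq> C" using conn_comp_of comp_of_self comp_of_subset a by metis+
  have RY: "?R \<inter> insert x Y = {}"
    using sep R a C(4) unfolding separates_def by blast
  then have RA: "?R \<subseteq> side ?E A Y"
    using R a by (intro subsetI sideI[of ?E ?R]) auto
  then have "y \<notin> ?R" using disj y by blast
  have "C \<subseteq> ?R"
  proof (rule conn_closedD[OF C(1)])
    show "?R \<inter> C \<noteq> {}" using R by blast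
  next
    fix u v assume u: "u \<in> ?R" and v: "v \<in> C" and "(u, v) \<in> E"
    then have "(u, v) \<in> ?E" using RY \<open>y \<notin> ?R\<close> by blast
    then have "conn ?E (insert v ?R)" using conn_insert[OF sym' R(1) u] by blast
    then have "insert v ?R \<subseteq> ?R" using v R u by (intro conn_subset_comp_of) (use a in auto)
    then show "v \<in> ?R" by blast
  qed
  then have "s \<in> ?R" using s by blast
  then have "s \<in> side ?E A Y" "s \<in> side ?E S Y"
    using RA RY s by (auto intro: side_base)
  with disj show False by blast
qed

text \<open>A connected set that avoids \<open>Y\<close> and joins \<open>A\<close> to
  \<open>S\<close> can leave the \<open>A\<close>-side only through the deleted edge, and likewise
  the \<open>S\<close>-side. The sides are disjoint, so the edge has one end on each.\<close>

lemma deleted_edge_crosses: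
  assumes "sym E" "separates (E - {(p, q), (q, p)}) A S Y" "\<not> separates E A S Y"
  obtains x y where "(x, y) \<in> {(p, q), (q, p)}"
    "x \<in> side (E - {(p, q), (q, p)}) A Y" "y \<in> side (E - {(p, q), (q, p)}) S Y"
proof -
  let ?E = "E - {(p, q), (q, p)}"
  have sym': "sym ?E" using assms(1) unfolding sym_def by blast
  have disj: "side ?E A Y \<inter> side ?E S Y = {}" using sides_disjoint assms(2) .
  obtain C a s where C: "conn E C" "C \<inter> Y = {}" "a \<in> C" "a \<in> A" "s \<in> C" "s \<in> S"
    using assms(3) unfolding separates_def by blast
  have aA: "a \<in> side ?E A Y" and sS: "s \<in> side ?E S Y"
    using C by (auto intro: side_base)
  have cross: "\<exists>u v. u \<in> side ?E B Y \<and> v \<notin> side ?E B Y \<and> (u, v) \<in> {(p, q), (q, p)}"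
    if bc: "b \<in> C" "b \<in> side ?E B Y" "c \<in> C" "c \<notin> side ?E B Y" for b c B
  proof -
    obtain u v where uv: "u \<in> C" "u \<in> side ?E B Y" "v \<in> C" "v \<notin> side ?E B Y" "(u, v) \<in> E"
      using conn_crossing[OF C(1) bc] by metis
    then have "(u, v) \<notin> ?E" using side_step[OF sym' uv(2)] C(2) by blast
    with uv show ?thesis by blast
  qed
  obtain u v where uv: "u \<in> side ?E A Y" "v \<notin> side ?E A Y" "(u, v) \<in> {(p, q), (q, p)}"
    using cross[OF C(3) aA C(5)] sS disj by blast
  obtain u' v' where uv': "u' \<in> side ?E S Y" "v' \<notin> side ?E S Y" "(u', v') \<in> {(p, q), (q, p)}"
    using cross[OF C(5) sS C(3)] aA disj by blast
  have "u' = v" using uv uv' disj by blast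
  then show ?thesis using that[of u v] uv uv' by blast
qed

lemma linked_mono:
  assumes "linked E A S k" "E \<subseteq> E'"
  shows "linked E' A S k"
proof -
  have "conn E' P" if "conn E P" for P using conn_mono[OF that] assms(2) by blast
  then show ?thesis using assms(1) unfolding linked_def by blast
qed

text \<open>
  Delete an edge. If afterwards some \<open>Y\<close> with fewer than \<open>k\<close> elements separates \<open>A\<close> from \<open>S\<close>,
  the edge joins some \<open>x\<close> on the \<open>A\<close>-side of \<open>Y\<close> to some \<open>y\<close> on the \<open>S\<close>-side, and linkages from
  \<open>A\<close> to \<open>Y \<union> {x}\<close> and from \<open>S\<close> to \<open>Y \<union> {y}\<close> are glued along \<open>Y\<close> and this edge.
\<close>

theorem menger:
  assumes "finite E" "sym E"
    and "\<And>X. finite X \<Longrightarrow> separates E A S X \<Longrightarrow> k \<le> card X"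
  shows "linked E A S k"
  using assms
proof (induction "card E" arbitrary: E A S rule: less_induct)
  case less
  show ?case
  proof (cases "E = {}")
    case True
    have "\<exists>v. C = {v}" if C: "conn E C" for C
    proof -
      obtain v where "v \<in> C" using conn_nonempty[OF C] by blast
      then have "C \<subseteq> {v}" using C True by (intro conn_closedD[of E C "{v}"]) auto
      with \<open>v \<in> C\<close> show ?thesis by blast
    qed
    \<comment> \<open>Without edges only the vertices common to \<open>A\<close> and
      \<open>S\<close> join the two sets. Their number is at least \<open>k\<close> if finite, and
      otherwise any \<open>k\<close> of them can be picked.\<close>
    then have "separates E A S (A \<inter> S)" unfolding separates_def by blast
    then have "\<exists>I\<subseteq>A \<inter> S. finite I \<and> card I = k"
      using less.prems(3)[of "A \<inter> S"]
      by (metis infinite_arbitrarily_large obtain_subset_with_card_n)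
    then obtain I where "I \<subseteq> A \<inter> S" "finite I" "card I = k" by blast
    then show ?thesis
      by (intro linkedI[of I k "\<lambda>v. {v}"]) (auto simp: conn_singleton disjoint_family_on_def)
  next
    case False
    then obtain p q where pq: "(p, q) \<in> E" by fast
    let ?E = "E - {(p, q), (q, p)}"
    have sym': "sym ?E" using less.prems(2) unfolding sym_def by blast
    have fin': "finite ?E" and less': "card ?E < card E"
      using less.prems(1) pq by (auto intro!: psubset_card_mono)
    show ?thesis
    proof (cases "\<exists>Y. finite Y \<and> separates ?E A S Y \<and> card Y < k")
      case False
      then have "linked ?E A S k"
        by (intro less.hyps[OF less' fin' sym']) (meson not_less)
      then show ?thesis by (rule linked_mono) blast
    next
      case True
      then obtain Y where Y: "finite Y" "separates ?E A S Y" "card Y < k" by blast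
      then have "\<not> separates E A S Y" using less.prems(3) not_less by blast
      from deleted_edge_crosses[OF less.prems(2) Y(2) this]
      obtain x y where xy_pq: "(x, y) \<in> {(p, q), (q, p)}"
        and x: "x \<in> side ?E A Y" and y: "y \<in> side ?E S Y" .
      have xyE: "(x, y) \<in> E" using xy_pq pq less.prems(2) by (auto dest: symD)
      have eq: "{(x, y), (y, x)} = {(p, q), (q, p)}" using xy_pq by auto
      have disj: "side ?E A Y \<inter> side ?E S Y = {}" using sides_disjoint Y(2) .
      have eq': "{(y, x), (x, y)} = {(p, q), (q, p)}" using xy_pq by auto
      have card_x: "card (insert x Y) \<le> k" and card_y: "card (insert y Y) \<le> k"
        using Y(1,3) by (auto simp: card_insert_if)
      have "linked ?E A (insert x Y) k"
      proof (rule less.hyps[OF less' fin' sym'])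
        fix X assume "finite X" "separates ?E A (insert x Y) X"
        moreover from this have "separates E A S X"
          using separates_insert_end[of E x y A S Y X] less.prems(2) Y(2) x y unfolding eq by simp
        ultimately show "k \<le> card X" using less.prems(3) by simp
      qed
      then obtain P where P: "\<And>z. z \<in> insert x Y \<Longrightarrow> conn ?E (P z)"
          "\<And>z. z \<in> insert x Y \<Longrightarrow> P z \<inter> A \<noteq> {}"
          "\<And>z. z \<in> insert x Y \<Longrightarrow> P z \<inter> insert x Y = {z}"
          "\<And>z. z \<in> insert x Y \<Longrightarrow> P z \<subseteq> insert z (side ?E A (insert x Y))"
          "disjoint_family_on P (insert x Y)" and card1: "card (insert x Y) = k"
        by (rule linked_onto[OF sym' _ _ card_x]) (use Y(1) in auto)
      have "linked ?E S (insert y Y) k"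
      proof (rule less.hyps[OF less' fin' sym'])
        fix X assume "finite X" "separates ?E S (insert y Y) X"
        moreover from this have "separates E S A X"
          using separates_insert_end[of E y x S A Y X] less.prems(2) Y(2) x y
          unfolding eq' separates_commute[of ?E A] by simp
        ultimately show "k \<le> card X" using less.prems(3) separates_commute by metis
      qed
      then obtain Q where Q: "\<And>z. z \<in> insert y Y \<Longrightarrow> conn ?E (Q z)"
          "\<And>z. z \<in> insert y Y \<Longrightarrow> Q z \<inter> S \<noteq> {}"
          "\<And>z. z \<in> insert y Y \<Longrightarrow> Q z \<inter> insert y Y = {z}"
          "\<And>z. z \<in> insert y Y \<Longrightarrow> Q z \<subseteq> insert z (side ?E S (insert y Y))"
          "disjoint_family_on Q (insert y Y)"
        by (rule linked_onto[OF sym' _ _ card_y]) (use Y(1) in auto)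
      have xY: "x \<notin> Y" and yY: "y \<notin> Y" and neq: "x \<noteq> y"
        using x y side_disjoint[of ?E A Y] side_disjoint[of ?E S Y] disj by blast+
      \<comment> \<open>Pairs the ends of the two linkages: each vertex of \<open>Y\<close> with
        itself, and \<open>x\<close> with \<open>y\<close> across the deleted edge.\<close>
      define r where "r z = (if z = x then y else z)" for z
      have r: "r z \<in> insert y Y" if "z \<in> insert x Y" for z using that by (auto simp: r_def)
      have r_inj: "r z \<noteq> r w" if "z \<in> insert x Y" "w \<in> insert x Y" "z \<noteq> w" for z w
        using that xY yY neq by (auto simp: r_def)
      have PA: "P z \<subseteq> side ?E A Y \<union> {v. v = z \<and> z \<in> Y}" if "z \<in> insert x Y" for z
        using P(4)[OF that] side_antimono[of Y "insert x Y" ?E A] that x by blast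
      have QS: "Q z \<subseteq> side ?E S Y \<union> {v. v = z \<and> z \<in> Y}" if "z \<in> insert y Y" for z
        using Q(4)[OF that] side_antimono[of Y "insert y Y" ?E S] that y by blast
      \<comment> \<open>Off \<open>Y\<close> the sets of the two linkages lie on different sides. On
        \<open>Y\<close> each contains at most its own index, so a common vertex would force
        \<open>z = w\<close>.\<close>
      have PQ: "P z \<inter> Q (r w) = {}" if "z \<in> insert x Y" "w \<in> insert x Y" "z \<noteq> w" for z w
      proof (rule ccontr)
        assume "P z \<inter> Q (r w) \<noteq> {}"
        then obtain v where v: "v \<in> P z" "v \<in> Q (r w)" by blast
        have vA: "v \<in> side ?E A Y \<or> v = z \<and> z \<in> Y"
          using subsetD[OF PA[OF that(1)] v(1)] by simp
        have vS: "v \<in> side ?E S Y \<or> v = r w \<and> r w \<in> Y"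
          using subsetD[OF QS[OF r[OF that(2)]] v(2)] by simp
        have "v \<notin> side ?E A Y \<or> v \<notin> side ?E S Y" using disj by blast
        moreover have "v \<in> side ?E A Y \<Longrightarrow> v \<notin> Y" "v \<in> side ?E S Y \<Longrightarrow> v \<notin> Y"
          using side_disjoint[of ?E A Y] side_disjoint[of ?E S Y] by blast+
        ultimately have "z = r w" "z \<in> Y" using vA vS by blast+
        then show False using that yY by (simp add: r_def split: if_splits)
      qed
      show ?thesis
      proof (rule linkedI)
        show "finite (insert x Y)" "card (insert x Y) = k" using Y card1 by auto
        show "disjoint_family_on (\<lambda>z. P z \<union> Q (r z)) (insert x Y)"
          unfolding disjoint_family_on_def
        proof (intro ballI impI)
          fix z w assume zw: "z \<in> insert x Y" "w \<in> insert x Y" "z \<noteq> w"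
          have "P z \<inter> P w = {}" using P(5) zw unfolding disjoint_family_on_def by blast
          moreover have "Q (r z) \<inter> Q (r w) = {}"
            using Q(5) r[OF zw(1)] r[OF zw(2)] r_inj[OF zw] unfolding disjoint_family_on_def by blast
          ultimately show "(P z \<union> Q (r z)) \<inter> (P w \<union> Q (r w)) = {}"
            using PQ[OF zw] PQ[OF zw(2,1)] zw(3) by blast
        qed
      next
        fix z assume z: "z \<in> insert x Y"
        have Pz: "conn E (P z)" by (rule conn_mono[OF P(1)[OF z]]) simp
        have Qz: "conn E (Q (r z))" by (rule conn_mono[OF Q(1)[OF r[OF z]]]) simp
        have zP: "z \<in> P z" using P(3)[OF z] by blast
        have zQ: "r z \<in> Q (r z)" using Q(3)[OF r[OF z]] by blast
        have "conn E (P z \<union> Q (r z))"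
        proof (cases "z = x")
          case True
          then have "(z, r z) \<in> E" using xyE by (simp add: r_def)
          then show ?thesis by (rule conn_Un_adj[OF less.prems(2) Pz Qz zP zQ])
        next
          case False
          then have "z \<in> Q (r z)" using zQ by (simp add: r_def)
          then show ?thesis by (rule conn_Un[OF Pz Qz zP])
        qed
        moreover have "(P z \<union> Q (r z)) \<inter> A \<noteq> {}" using P(2)[OF z] by blast
        moreover have "(P z \<union> Q (r z)) \<inter> S \<noteq> {}" using Q(2)[OF r[OF z]] by blast
        ultimately show "conn E (P z \<union> Q (r z)) \<and> (P z \<union> Q (r z)) \<inter> A \<noteq> {} \<and> (P z \<union> Q (r z)) \<inter> S \<noteq> {}"
          by blast
      qed
    qed
  qed
qed

section \<open>Rooted path models\<close>

definition adjacent :: "'a rel \<Rightarrow> 'a set \<Rightarrow> 'a set \<Rightarrow> bool" where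
  "adjacent E A B \<longleftrightarrow> (\<exists>a\<in>A. \<exists>b\<in>B. (a, b) \<in> E)"

text \<open>A rooted model of a path, its branch sets listed in path order. Containment in a vertex
  set is stated separately, so that the vertex set can shrink in an induction while \<open>E\<close>
  stays fixed.\<close>

definition pmodel :: "'a rel \<Rightarrow> 'a set \<Rightarrow> 'a set list \<Rightarrow> bool" where
  "pmodel E S Bs \<longleftrightarrow> (\<forall>B\<in>set Bs. conn E B \<and> B \<inter> S \<noteq> {}) \<and>
     sorted_wrt disjnt Bs \<and> successively (adjacent E) Bs"

lemma pmodel_append:
  "pmodel E S (As @ Bs) \<longleftrightarrow> pmodel E S As \<and> pmodel E S Bs \<and>
     \<Union>(set As) \<inter> \<Union>(set Bs) = {} \<and> (As = [] \<or> Bs = [] \<or> adjacent E (last As) (hd Bs))"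
  unfolding pmodel_def sorted_wrt_append successively_append_iff disjnt_def by auto

lemma pmodel_Nil [simp]: "pmodel E S []"
  by (simp add: pmodel_def)

lemma pmodel_single [simp]: "pmodel E S [B] \<longleftrightarrow> conn E B \<and> B \<inter> S \<noteq> {}"
  by (simp add: pmodel_def)

lemma pmodel_Cons:
  "pmodel E S (B # Bs) \<longleftrightarrow> conn E B \<and> B \<inter> S \<noteq> {} \<and> pmodel E S Bs \<and>
     B \<inter> \<Union>(set Bs) = {} \<and> (Bs = [] \<or> adjacent E B (hd Bs))"
  using pmodel_append[of E S "[B]" Bs] by simp

lemma adjacent_mono: "adjacent E A B \<Longrightarrow> A \<subseteq> A' \<Longrightarrow> B \<subseteq> B' \<Longrightarrow> adjacent E A' B'"
  unfolding adjacent_def by blast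

lemma adjacent_commute: "sym E \<Longrightarrow> adjacent E A B \<longleftrightarrow> adjacent E B A"
  unfolding adjacent_def by (meson symD)

lemma pmodel_rev:
  assumes "sym E" "pmodel E S Bs"
  shows "pmodel E S (rev Bs)"
  using assms(2)
proof (induction Bs)
  case (Cons B Bs)
  then show ?case
    using adjacent_commute[OF assms(1), of B "hd Bs"]
    by (auto simp: pmodel_Cons pmodel_append last_rev)
qed simp

lemma conn_pmodel:
  assumes "sym E" "pmodel E S Bs" "Bs \<noteq> []"
  shows "conn E (\<Union>(set Bs))"
  using assms(2,3)
proof (induction Bs)
  case (Cons B Bs)
  show ?case
  proof (cases "Bs = []")
    case True
    then show ?thesis using Cons.prems by simp
  next
    case False
    then have B: "conn E B" "conn E (\<Union>(set Bs))" and "adjacent E B (hd Bs)"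
      using Cons by (auto simp: pmodel_Cons)
    then obtain u v where "u \<in> B" "v \<in> hd Bs" "(u, v) \<in> E" unfolding adjacent_def by blast
    moreover have "hd Bs \<in> set Bs" using False by simp
    ultimately have "conn E (B \<union> \<Union>(set Bs))"
      using conn_Un_adj[OF assms(1) B, of u v] by blast
    then show ?thesis by simp
  qed
qed simp

section \<open>Joining two disjoint models\<close>

lemma pmodel_take: "pmodel E S Bs \<Longrightarrow> pmodel E S (take n Bs)"
  using pmodel_append[of E S "take n Bs" "drop n Bs"] by simp

text \<open>Of the two pieces before and after \<open>A\<close>, keep the longer one, reversed if it
  comes after \<open>A\<close>. With \<open>A\<close> in last position, a bridge can be attached
  there.\<close>

lemma pmodel_longer_half:
  assumes "sym E" "pmodel E S As" "A \<in> set As"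
  obtains Zs where "pmodel E S (Zs @ [A])" "\<Union>(set (Zs @ [A])) \<subseteq> \<Union>(set As)"
    "\<Union>(set Zs) \<inter> A = {}" "length As \<le> 2 * length Zs + 1"
proof -
  obtain Xs Ys where As: "As = Xs @ A # Ys" using assms(3) by (meson split_list)
  have X: "pmodel E S (Xs @ [A])"
    using assms(2) pmodel_append[of E S "Xs @ [A]" Ys] by (simp add: As)
  have "pmodel E S (A # Ys)"
    using assms(2) pmodel_append[of E S Xs "A # Ys"] by (simp add: As)
  then have Y: "pmodel E S (rev Ys @ [A])" using pmodel_rev[OF assms(1)] by fastforce
  show ?thesis
  proof (cases "length Ys \<le> length Xs")
    case True
    show ?thesis by (rule that[OF X]) (use X True in \<open>auto simp: As pmodel_append\<close>)
  next
    case False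
    show ?thesis by (rule that[OF Y]) (use Y False in \<open>auto simp: As pmodel_append\<close>)
  qed
qed

text \<open>A bridge inside \<open>K\<close> leads from a branch set \<open>P\<close> of one model
  to a branch set \<open>Q\<close> of the other. It is absorbed into \<open>P\<close>, and the
  longer halves of the two models, ending in \<open>P\<close> and \<open>Q\<close>, are
  concatenated.\<close>

lemma pmodel_join:
  assumes E: "sym E" and K: "conn E K"
    and A: "pmodel E S As" "\<Union>(set As) \<subseteq> K" and B: "pmodel E S Bs" "\<Union>(set Bs) \<subseteq> K"
    and disj: "\<Union>(set As) \<inter> \<Union>(set Bs) = {}"
    and len: "length As = k" "length Bs = k" "0 < k"
  obtains Cs where "pmodel E S Cs" "\<Union>(set Cs) \<subseteq> K" "length Cs = Suc k"
proof -
  let ?M = "\<Union>(set As)" and ?N = "\<Union>(set Bs)"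
  have "As \<noteq> []" "Bs \<noteq> []" using len by auto
  then have M: "conn E ?M" and N: "conn E ?N"
    using conn_pmodel[OF E A(1)] conn_pmodel[OF E B(1)] by simp_all
  obtain m0 where m0: "m0 \<in> ?M" using conn_nonempty[OF M] by blast
  obtain n0 where n0: "n0 \<in> ?N" using conn_nonempty[OF N] by blast
  \<comment> \<open>Go from \<open>?N\<close> to the first vertex \<open>m\<close> of
    \<open>?M\<close>, then back from \<open>m\<close> inside \<open>T\<close> to just before the
    first vertex \<open>n\<close> of \<open>?N\<close>. The resulting \<open>D\<close> meets
    \<open>?M\<close> only in \<open>m\<close> and misses \<open>?N\<close>.\<close>
  obtain T m where T: "conn E T" "T \<subseteq> K" "n0 \<in> T" "T \<inter> ?M = {m}"
  proof -
    have "n0 \<in> K" "K \<inter> ?M \<noteq> {}" using m0 n0 A(2) B(2) by blast+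
    then show ?thesis using conn_trim[OF E K] that by metis
  qed
  have m: "m \<in> T" "m \<in> ?M" "m \<notin> ?N" using T(4) disj by blast+
  have "T \<inter> ?N \<noteq> {}" using T(3) n0 by blast
  from conn_first_hit[OF E T(1) m(1,3) this]
  obtain D d n where D: "conn E D" "m \<in> D" "D \<subseteq> T" "D \<inter> ?N = {}" "d \<in> D" "n \<in> T" "n \<in> ?N" "(d, n) \<in> E" .
  obtain P where P: "P \<in> set As" "m \<in> P" using m by blast
  obtain Q where Q: "Q \<in> set Bs" "n \<in> Q" using D by blast
  obtain Xs where X: "pmodel E S (Xs @ [P])" "\<Union>(set (Xs @ [P])) \<subseteq> ?M"
      "\<Union>(set Xs) \<inter> P = {}" "length As \<le> 2 * length Xs + 1"
    using pmodel_longer_half[OF E A(1) P(1)] .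
  obtain Ys where Y: "pmodel E S (Ys @ [Q])" "\<Union>(set (Ys @ [Q])) \<subseteq> ?N"
      "\<Union>(set Ys) \<inter> Q = {}" "length Bs \<le> 2 * length Ys + 1"
    using pmodel_longer_half[OF E B(1) Q(1)] .
  have Xs: "\<Union>(set Xs) \<subseteq> ?M" "m \<notin> \<Union>(set Xs)" using X(2,3) P(2) by auto
  then have "D \<inter> \<Union>(set Xs) \<subseteq> {m}" using Int_mono[OF D(3) Xs(1)] T(4) by simp
  then have DX: "D \<inter> \<Union>(set Xs) = {}" using Xs(2) by blast
  have conn: "conn E (P \<union> D)"
    using X(1) D(1,2) P(2) by (intro conn_Un[where v = m]) (auto simp: pmodel_append)
  have "pmodel E S (Xs @ [P \<union> D])"
    using X(1,3) DX conn adjacent_mono[of E "last Xs" P "last Xs" "P \<union> D"]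
    by (auto simp: pmodel_append)
  moreover have "pmodel E S (Q # rev Ys)"
    using pmodel_rev[OF E Y(1)] by simp
  moreover have "adjacent E (P \<union> D) Q"
    using D Q unfolding adjacent_def by blast
  moreover have "\<Union>(set (Xs @ [P \<union> D])) \<inter> \<Union>(set (Q # rev Ys)) = {}"
  proof -
    have "\<Union>(set (Xs @ [P \<union> D])) \<subseteq> ?M \<union> D" using X(2) by auto
    moreover have "\<Union>(set (Q # rev Ys)) \<subseteq> ?N" using Y(2) by auto
    ultimately show ?thesis using D(4) disj by blast
  qed
  ultimately have C: "pmodel E S ((Xs @ [P \<union> D]) @ (Q # rev Ys))"
    unfolding pmodel_append[of E S "Xs @ [P \<union> D]"] by simp
  let ?C = "(Xs @ [P \<union> D]) @ (Q # rev Ys)"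
  have CK: "\<Union>(set ?C) \<subseteq> K"
    using X(2) Y(2) A(2) B(2) D(3) T(2) by simp blast
  \<comment> \<open>The halves contribute at least \<open>k - 1\<close> branch sets besides
    \<open>P\<close> and \<open>Q\<close>; any surplus is cut off by \<open>take\<close>.\<close>
  have "Suc k \<le> length ?C" using X(4) Y(4) len by simp
  then show ?thesis
    using that[of "take (Suc k) ?C"] pmodel_take[OF C] CK set_take_subset[of "Suc k" ?C]
    by (metis Union_mono length_take min_absorb2 order_trans)
qed

section \<open>Paths that meet all models, and models along a path\<close>

text \<open>\<open>M\<close> will stand for being the union of a model. If some \<open>C\<close>
  with \<open>M C\<close> avoids \<open>a\<close>, it lies in one component of
  \<open>K - {a}\<close>; every other such set avoiding \<open>a\<close> meets \<open>C\<close>, so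
  it lies in the same component. The path steps from \<open>a\<close> into that component and
  continues there by induction.\<close>

lemma ex_hitting_path:
  assumes "sym E" "finite K" "conn E K" "a \<in> K"
    and "\<And>C D. conn E C \<Longrightarrow> conn E D \<Longrightarrow> C \<subseteq> K \<Longrightarrow> D \<subseteq> K \<Longrightarrow> M C \<Longrightarrow> M D \<Longrightarrow> C \<inter> D \<noteq> {}"
  shows "\<exists>p. p \<noteq> [] \<and> hd p = a \<and> distinct p \<and> set p \<subseteq> K \<and> successively (\<lambda>u v. (u, v) \<in> E) p \<and>
    (\<forall>C. conn E C \<longrightarrow> C \<subseteq> K - set p \<longrightarrow> \<not> M C)"
  using assms(2-5)
proof (induction "card K" arbitrary: K a rule: less_induct)
  case less
  show ?case
  proof (cases "\<exists>C. conn E C \<and> C \<subseteq> K - {a} \<and> M C")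
    case False
    then show ?thesis using less.prems by (intro exI[of _ "[a]"]) auto
  next
    case True
    then obtain C where C: "conn E C" "C \<subseteq> K - {a}" "M C" by blast
    then obtain v where v: "v \<in> C" "v \<in> K - {a}" using conn_nonempty by blast
    let ?K = "comp_of E (K - {a}) v"
    have K: "conn E ?K" "v \<in> ?K" "?K \<subseteq> K - {a}"
      using conn_comp_of[OF v(2)] comp_of_self[OF v(2)] comp_of_subset by metis+
    have CK: "C \<subseteq> ?K" using conn_subset_comp_of[OF v(2) C(1,2)] K(2) v(1) by blast
    have "v \<in> K" "a \<notin> ?K" using K(3) v(2) by blast+
    then obtain d n where d: "d \<in> ?K" "n \<in> K" "n \<notin> ?K" "(d, n) \<in> E"
      using conn_crossing[OF less.prems(2) _ K(2) less.prems(3)] by metis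
    \<comment> \<open>Any other end of an edge leaving \<open>?K\<close> could be added to the
      component.\<close>
    have "n = a"
    proof (rule ccontr)
      assume "n \<noteq> a"
      then have "insert n ?K \<subseteq> ?K"
        using conn_subset_comp_of[OF v(2) conn_insert[OF assms(1) K(1) d(1,4)]] d(1,2) K(3) by blast
      with d show False by blast
    qed
    have "?K \<subset> K" using K(3) less.prems(3) by blast
    then have "card ?K < card K" "finite ?K"
      using less.prems(1) by (simp_all add: psubset_card_mono finite_subset[OF psubset_imp_subset])
    moreover have "C \<inter> D \<noteq> {}"
      if "conn E C" "conn E D" "C \<subseteq> ?K" "D \<subseteq> ?K" "M C" "M D" for C D
      using less.prems(4)[OF that(1,2)] that(3-6) K(3) by blast
    ultimately have "\<exists>p. p \<noteq> [] \<and> hd p = d \<and> distinct p \<and> set p \<subseteq> ?K \<and>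
      successively (\<lambda>u v. (u, v) \<in> E) p \<and> (\<forall>C. conn E C \<longrightarrow> C \<subseteq> ?K - set p \<longrightarrow> \<not> M C)"
      by (intro less.hyps K(1) d(1))
    then obtain p where p: "p \<noteq> []" "hd p = d" "distinct p" "set p \<subseteq> ?K" "successively (\<lambda>u v. (u, v) \<in> E) p"
      "\<And>C. conn E C \<Longrightarrow> C \<subseteq> ?K - set p \<Longrightarrow> \<not> M C"
      by blast
    have "\<not> M D" if D: "conn E D" "D \<subseteq> K - set (a # p)" for D
    proof
      assume "M D"
      then have "C \<inter> D \<noteq> {}" using less.prems(4) C D by blast
      then have "D \<subseteq> ?K"
        using conn_subset_comp_of[OF v(2) D(1)] D(2) CK by fastforce
      then show False using p(6)[OF D(1)] D(2) \<open>M D\<close> by auto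
    qed
    moreover have "(a, d) \<in> E" using assms(1) d(4) \<open>n = a\<close> by (auto dest: symD)
    ultimately show ?thesis
      using p K(3) less.prems(3) by (intro exI[of _ "a # p"]) (auto simp: successively_Cons)
  qed
qed

text \<open>The branch sets are ordered by where they meet \<open>p\<close>. Working backwards from
  the end of \<open>p\<close>, a vertex in some \<open>R\<close> puts \<open>R\<close> in front as a
  new branch set; any other vertex is absorbed into the current first branch set, if there is one.
  The invariant \<open>hd p \<in> hd Bs\<close> gives the adjacency to what is put in front.\<close>

lemma pmodel_along_path:
  assumes "sym E" "distinct p" "successively (\<lambda>u v. (u, v) \<in> E) p"
    and "finite \<P>" "pairwise disjnt \<P>"
    and "\<And>R. R \<in> \<P> \<Longrightarrow> conn E R \<and> R \<inter> S \<noteq> {} \<and> (\<exists>r. R \<inter> set p = {r})"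
  shows "\<exists>Bs. pmodel E S Bs \<and> length Bs = card \<P> \<and> \<Union>(set Bs) \<subseteq> \<Union>\<P> \<union> set p \<and>
    (Bs \<noteq> [] \<longrightarrow> hd p \<in> hd Bs)"
  using assms(2-)
proof (induction p arbitrary: \<P>)
  case Nil
  then have "\<P> = {}" by auto
  then show ?case by (intro exI[of _ "[]"]) simp
next
  case (Cons a p)
  have p: "distinct p" "successively (\<lambda>u v. (u, v) \<in> E) p" "a \<notin> set p"
    and ap: "p \<noteq> [] \<Longrightarrow> (a, hd p) \<in> E"
    using Cons.prems(1,2) by (auto simp: successively_Cons)
  show ?case
  proof (cases "\<exists>R\<in>\<P>. a \<in> R")
    case False
    then have "\<exists>r. R \<inter> set p = {r}" if "R \<in> \<P>" for R
      using Cons.prems(5)[OF that] that by auto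
    with Cons.IH[OF p(1,2) Cons.prems(3,4)] Cons.prems(5)
    obtain Bs where Bs: "pmodel E S Bs" "length Bs = card \<P>" "\<Union>(set Bs) \<subseteq> \<Union>\<P> \<union> set p"
      "Bs \<noteq> [] \<Longrightarrow> hd p \<in> hd Bs" by blast
    show ?thesis
    proof (cases Bs)
      case Nil
      then show ?thesis using Bs by (intro exI[of _ Bs]) auto
    next
      case (Cons B Cs)
      have "p \<noteq> []"
      proof
        assume "p = []"
        then have "\<P> = {}" using \<open>\<And>R. R \<in> \<P> \<Longrightarrow> \<exists>r. R \<inter> set p = {r}\<close> by auto
        then show False using Bs(2) Cons by simp
      qed
      have "hd p \<in> B" using Bs(4) Cons by simp
      then have "conn E (insert a B)"
        using conn_insert[OF assms(1)] ap[OF \<open>p \<noteq> []\<close>] Bs(1) Cons assms(1)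
        by (metis pmodel_Cons symD)
      moreover have "a \<notin> \<Union>(set Cs)" using Bs(3) False p(3) Cons by auto
      ultimately have "pmodel E S (insert a B # Cs)"
        using Bs(1) adjacent_mono[of E B "hd Cs" "insert a B" "hd Cs"]
        unfolding Cons pmodel_Cons by auto
      then show ?thesis using Bs(2,3) Cons
        by (intro exI[of _ "insert a B # Cs"]) auto
    qed
  next
    case True
    then obtain R where R: "R \<in> \<P>" "a \<in> R" by blast
    have Rp: "R \<inter> set p = {}" using Cons.prems(5)[OF R(1)] R(2) p(3) by auto
    have dis: "R \<inter> R' = {}" if "R' \<in> \<P> - {R}" for R'
      using Cons.prems(4) R(1) that unfolding pairwise_def disjnt_def by blast
    have "\<exists>r. R' \<inter> set p = {r}" if "R' \<in> \<P> - {R}" for R'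
    proof -
      have "a \<notin> R'" using dis[OF that] R(2) by blast
      then show ?thesis using Cons.prems(5)[of R'] that by simp
    qed
    then have IHp: "\<And>R'. R' \<in> \<P> - {R} \<Longrightarrow> conn E R' \<and> R' \<inter> S \<noteq> {} \<and> (\<exists>r. R' \<inter> set p = {r})"
      using Cons.prems(5) by blast
    have "pairwise disjnt (\<P> - {R})" using Cons.prems(4) by (rule pairwise_subset) blast
    with Cons.IH[OF p(1,2) _ _ IHp] Cons.prems(3)
    obtain Bs where Bs: "pmodel E S Bs" "length Bs = card (\<P> - {R})"
      "\<Union>(set Bs) \<subseteq> \<Union>(\<P> - {R}) \<union> set p" "Bs \<noteq> [] \<Longrightarrow> hd p \<in> hd Bs"
      by (metis finite_Diff)
    have RBs: "R \<inter> \<Union>(set Bs) = {}" using Bs(3) Rp dis by blast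
    have "adjacent E R (hd Bs)" if "Bs \<noteq> []"
    proof -
      have "p \<noteq> []"
      proof
        assume "p = []"
        then have "\<P> - {R} = {}" using IHp by auto
        then show False using Bs(2) that unfolding \<open>\<P> - {R} = {}\<close> by simp
      qed
      then show ?thesis using ap Bs(4)[OF that] R(2) unfolding adjacent_def by blast
    qed
    then have "pmodel E S (R # Bs)"
      using Bs(1) RBs Cons.prems(5)[OF R(1)] by (auto simp: pmodel_Cons)
    moreover have "length (R # Bs) = card \<P>"
      using Bs(2) card_Suc_Diff1[OF Cons.prems(3) R(1)] by simp
    ultimately show ?thesis
      using Bs(3) R by (intro exI[of _ "R # Bs"]) auto
  qed
qed

text \<open>Each linking set is trimmed, starting from \<open>S\<close>, at its first vertex on
  \<open>p\<close>, since \<open>pmodel_along_path\<close> asks for exactly one common vertex with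
  \<open>p\<close>.\<close>

lemma pmodel_of_linked:
  assumes "sym E" "distinct p" "successively (\<lambda>u v. (u, v) \<in> E) p" "linked E (set p) S k"
    and "\<And>C. conn E C \<Longrightarrow> C \<inter> set p \<noteq> {} \<Longrightarrow> C \<subseteq> V"
  obtains Bs where "pmodel E S Bs" "length Bs = k" "\<Union>(set Bs) \<subseteq> V"
proof -
  have "linked E S (set p) k"
    using assms(4) unfolding linked_def by blast
  then obtain \<P> where \<P>: "finite \<P>" "card \<P> = k" "pairwise disjnt \<P>"
    and R: "\<And>R. R \<in> \<P> \<Longrightarrow> conn E R \<and> R \<inter> S \<noteq> {} \<and> R \<inter> set p \<noteq> {}"
    unfolding linked_def by blast
  have "\<exists>T. conn E T \<and> T \<subseteq> R \<and> T \<inter> S \<noteq> {} \<and> (\<exists>z. T \<inter> set p = {z})" if RP: "R \<in> \<P>" for R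
  proof -
    obtain s where s: "s \<in> R" "s \<in> S" using R[OF RP] by blast
    obtain T z where "conn E T" "T \<subseteq> R" "s \<in> T" "T \<inter> set p = {z}"
      using conn_trim[OF assms(1) _ s(1)] R[OF RP] by metis
    with s show ?thesis by blast
  qed
  then obtain T where T: "\<And>R. R \<in> \<P> \<Longrightarrow> conn E (T R) \<and> T R \<subseteq> R \<and> T R \<inter> S \<noteq> {} \<and> (\<exists>z. T R \<inter> set p = {z})"
    by metis
  have dis: "T R \<inter> T R' = {}" if "R \<in> \<P>" "R' \<in> \<P>" "R \<noteq> R'" for R R'
    using T[OF that(1)] T[OF that(2)] \<P>(3) that unfolding pairwise_def disjnt_def by blast
  have "inj_on T \<P>"
    using dis T by (intro inj_onI) (metis Int_absorb conn_nonempty)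
  then have card: "card (T ` \<P>) = k" using \<P>(2) by (simp add: card_image)
  have "pairwise disjnt (T ` \<P>)"
    using dis unfolding pairwise_def disjnt_def by (metis imageE)
  moreover have "conn E P \<and> P \<inter> S \<noteq> {} \<and> (\<exists>r. P \<inter> set p = {r})" if "P \<in> T ` \<P>" for P
    using that T by (metis imageE)
  ultimately obtain Bs where Bs: "pmodel E S Bs" "length Bs = k"
      "\<Union>(set Bs) \<subseteq> \<Union>(T ` \<P>) \<union> set p"
    using pmodel_along_path[OF assms(1-3), of "T ` \<P>" S] \<P>(1) card by (metis finite_imageI)
  have "T R \<subseteq> V" if "R \<in> \<P>" for R using assms(5) T[OF that] by blast
  moreover have "v \<in> V" if "v \<in> set p" for v using assms(5)[OF conn_singleton, of v] that by blast
  ultimately show ?thesis using that[OF Bs(1,2)] Bs(3) by blast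
qed

section \<open>Elimination forests as chains\<close>

text \<open>
  A forest on \<open>H\<close> is given by the root-to-\<open>v\<close> path \<open>c v\<close> of each vertex \<open>v\<close>. All connected
  subsets of \<open>V - H\<close> are considered instead of only the components, so that neighbours outside
  \<open>H\<close> have to be discarded.
\<close>

definition elim_chains ::
  "'a rel \<Rightarrow> 'a set \<Rightarrow> 'a set \<Rightarrow> 'a set \<Rightarrow> ('a \<Rightarrow> 'a list) \<Rightarrow> nat \<Rightarrow> bool" where
  "elim_chains E V S H c h \<longleftrightarrow> S \<subseteq> H \<and> H \<subseteq> V \<and>
     (\<forall>v\<in>H. c v \<noteq> [] \<and> last (c v) = v \<and> distinct (c v) \<and> length (c v) \<le> h \<and>
        set (c v) \<subseteq> H \<and> (\<forall>u\<in>set (c v). prefix (c u) (c v))) \<and>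
     (\<forall>u\<in>H. \<forall>v\<in>H. (u, v) \<in> E \<longrightarrow> u \<in> set (c v) \<or> v \<in> set (c u)) \<and>
     (\<forall>C. conn E C \<longrightarrow> C \<subseteq> V - H \<longrightarrow> E `` C \<inter> H = {} \<or> (\<exists>v\<in>H. E `` C \<inter> H \<subseteq> set (c v)))"

lemma elim_chains_empty: "elim_chains E V {} {} c h"
  by (simp add: elim_chains_def)

lemma elim_chains_mono: "elim_chains E V S H c h \<Longrightarrow> h \<le> h' \<Longrightarrow> elim_chains E V S H c h'"
  unfolding elim_chains_def by fastforce

text \<open>Makes \<open>x\<close> a common root. Every chain then contains \<open>x\<close>, which
  takes care of all edges at \<open>x\<close> and of \<open>x\<close> as a neighbour of an outside
  set, at the cost of one level.\<close>

lemma elim_chains_insert: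
  assumes "elim_chains E (V - {x}) (S - {x}) H c h" "x \<in> V"
  shows "elim_chains E V S (insert x H) (\<lambda>v. if v = x then [x] else x # c v) (Suc h)"
proof -
  let ?c = "\<lambda>v. if v = x then [x] else x # c v"
  have SH: "S - {x} \<subseteq> H" and HV: "H \<subseteq> V - {x}"
    and c: "\<And>v. v \<in> H \<Longrightarrow> c v \<noteq> [] \<and> last (c v) = v \<and> distinct (c v) \<and> length (c v) \<le> h \<and>
        set (c v) \<subseteq> H \<and> (\<forall>u\<in>set (c v). prefix (c u) (c v))"
    and edge: "\<And>u v. u \<in> H \<Longrightarrow> v \<in> H \<Longrightarrow> (u, v) \<in> E \<Longrightarrow> u \<in> set (c v) \<or> v \<in> set (c u)"
    and nb: "\<And>C. conn E C \<Longrightarrow> C \<subseteq> (V - {x}) - H \<Longrightarrow>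
      E `` C \<inter> H = {} \<or> (\<exists>v\<in>H. E `` C \<inter> H \<subseteq> set (c v))"
    using assms(1) unfolding elim_chains_def by simp_all
  have x: "x \<notin> H" using HV by blast
  show ?thesis
    unfolding elim_chains_def
  proof (intro conjI ballI allI impI)
    show "S \<subseteq> insert x H" using SH by blast
    show "insert x H \<subseteq> V" using HV assms(2) by blast
  next
    fix v assume v: "v \<in> insert x H"
    show "?c v \<noteq> []" by simp
    show "last (?c v) = v" "length (?c v) \<le> Suc h" using v c by auto
    show "distinct (?c v)" using v c x by auto
    show "set (?c v) \<subseteq> insert x H" using v c by auto
    fix u assume "u \<in> set (?c v)"
    then show "prefix (?c u) (?c v)" using v c x by (auto split: if_splits)
  next
    fix u v assume "u \<in> insert x H" "v \<in> insert x H" "(u, v) \<in> E"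
    then show "u \<in> set (?c v) \<or> v \<in> set (?c u)" using edge x by auto
  next
    fix C assume "conn E C" and C: "C \<subseteq> V - insert x H"
    moreover have "C \<subseteq> (V - {x}) - H" using C by blast
    ultimately consider "E `` C \<inter> H = {}" | v where "v \<in> H" "E `` C \<inter> H \<subseteq> set (c v)"
      using nb by blast
    then show "E `` C \<inter> insert x H = {} \<or> (\<exists>v\<in>insert x H. E `` C \<inter> insert x H \<subseteq> set (?c v))"
    proof cases
      \<comment> \<open>Here \<open>x\<close> is the only possible neighbour, so the chain of
        \<open>x\<close> suffices.\<close>
      case 1
      then have "E `` C \<inter> insert x H \<subseteq> set (?c x)" by auto
      then show ?thesis by blast
    next
      case 2
      then have "E `` C \<inter> insert x H \<subseteq> set (?c v)" using x by auto
      then show ?thesis using 2(1) by blast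
    qed
  qed
qed

lemma elim_chains_Un:
  assumes "finite X" "X \<subseteq> V" "\<exists>H c. elim_chains E (V - X) (S - X) H c h"
  shows "\<exists>H c. elim_chains E V S H c (card X + h)"
  using assms
proof (induction X arbitrary: V S)
  case (insert x X)
  have "X \<subseteq> V - {x}" using insert.prems(1) insert.hyps(2) by blast
  moreover have "\<exists>H c. elim_chains E (V - {x} - X) (S - {x} - X) H c h"
    using insert.prems(2) by (metis Diff_insert2)
  ultimately obtain H c where "elim_chains E (V - {x}) (S - {x}) H c (card X + h)"
    using insert.IH by blast
  moreover have "x \<in> V" using insert.prems(1) by blast
  ultimately have "elim_chains E V S (insert x H) (\<lambda>v. if v = x then [x] else x # c v) (Suc (card X + h))"
    by (rule elim_chains_insert)
  then show ?case using insert.hyps by auto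
qed simp

text \<open>Edges inside \<open>V\<close> and connected subsets of \<open>V\<close> stay within one
  component, so the forests of the components can be placed side by side.\<close>

lemma elim_chains_components:
  assumes sym: "sym E" and S: "S \<subseteq> V"
    and comp: "\<And>v. v \<in> V \<Longrightarrow> \<exists>H c. elim_chains E (comp_of E V v) (S \<inter> comp_of E V v) H c h"
  shows "\<exists>H c. elim_chains E V S H c h"
proof -
  let ?K = "comp_of E V"
  \<comment> \<open>Choosing per component rather than per vertex makes all vertices of a component
    refer to the same forest.\<close>
  have "\<forall>K\<in>?K ` V. \<exists>H c. elim_chains E K (S \<inter> K) H c h" using comp by blast
  then obtain HH cc where HH: "\<And>v. v \<in> V \<Longrightarrow> elim_chains E (?K v) (S \<inter> ?K v) (HH (?K v)) (cc (?K v)) h"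
    by (metis imageI)
  define H where "H = {v \<in> V. v \<in> HH (?K v)}"
  define c where "c v = cc (?K v) v" for v
  have sub: "HH (?K v) \<subseteq> ?K v" if "v \<in> V" for v
    using HH[OF that] by (simp add: elim_chains_def)
  have c: "c u = cc (?K v) u" if "v \<in> V" "u \<in> ?K v" for u v
    using comp_of_cong[OF that] by (simp add: c_def)
  have H: "H \<inter> ?K v = HH (?K v)" if "v \<in> V" for v
  proof -
    have "u \<in> H \<longleftrightarrow> u \<in> HH (?K v)" if u: "u \<in> ?K v" for u
      using comp_of_cong[OF \<open>v \<in> V\<close> u] u comp_of_subset[of E V v] by (auto simp: H_def)
    then show ?thesis using sub[OF that] by blast
  qed
  have adj: "w \<in> ?K v" if "v \<in> V" "u \<in> ?K v" "w \<in> V" "(u, w) \<in> E" for u v w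
  proof -
    have "insert w (?K v) \<subseteq> ?K v"
      using conn_subset_comp_of[OF that(1) conn_insert[OF sym conn_comp_of[OF that(1)] that(2,4)]]
        comp_of_subset[of E V v] that(2,3) by blast
    then show ?thesis by blast
  qed
  have HV: "H \<subseteq> V" by (auto simp: H_def)
  have "elim_chains E V S H c h"
    unfolding elim_chains_def
  proof (intro conjI ballI allI impI)
    show "S \<subseteq> H"
    proof
      fix s assume s: "s \<in> S"
      then have "s \<in> V" using S by blast
      then have "S \<inter> ?K s \<subseteq> HH (?K s)" using HH[of s] by (simp add: elim_chains_def)
      then show "s \<in> H" using s \<open>s \<in> V\<close> comp_of_self[of s V E] by (auto simp: H_def)
    qed
    show "H \<subseteq> V" by (fact HV)
  next
    fix v assume vH: "v \<in> H"
    then have v: "v \<in> V" "v \<in> HH (?K v)" by (auto simp: H_def)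
    have *: "cc (?K v) v \<noteq> [] \<and> last (cc (?K v) v) = v \<and> distinct (cc (?K v) v) \<and>
        length (cc (?K v) v) \<le> h \<and> set (cc (?K v) v) \<subseteq> HH (?K v) \<and>
        (\<forall>u\<in>set (cc (?K v) v). prefix (cc (?K v) u) (cc (?K v) v))"
      using HH[OF v(1)] v(2) unfolding elim_chains_def by simp
    then show "c v \<noteq> []" "last (c v) = v" "distinct (c v)" "length (c v) \<le> h" by (simp_all add: c_def)
    show "set (c v) \<subseteq> H" using * H[OF v(1)] by (auto simp: c_def)
    fix u assume u: "u \<in> set (c v)"
    then have "u \<in> ?K v" using * sub[OF v(1)] by (auto simp: c_def)
    then show "prefix (c u) (c v)" using * u c[OF v(1)] by (simp add: c_def)
  next
    fix u v assume uv: "u \<in> H" "v \<in> H" "(u, v) \<in> E"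
    then have u: "u \<in> V" "u \<in> HH (?K u)" by (auto simp: H_def)
    have vK: "v \<in> ?K u" using adj[OF u(1) comp_of_self[OF u(1)] _ uv(3)] uv(2) HV by blast
    then have "v \<in> HH (?K u)" using H[OF u(1)] uv(2) by blast
    then have "u \<in> set (cc (?K u) v) \<or> v \<in> set (cc (?K u) u)"
      using HH[OF u(1)] u(2) uv(3) unfolding elim_chains_def by simp
    then show "u \<in> set (c v) \<or> v \<in> set (c u)" using c[OF u(1) vK] by (simp add: c_def)
  next
    fix C assume C: "conn E C" "C \<subseteq> V - H"
    obtain w where w: "w \<in> C" using conn_nonempty[OF C(1)] by blast
    then have wV: "w \<in> V" using C(2) by blast
    have CK: "C \<subseteq> ?K w"
      using conn_subset_comp_of[OF wV C(1)] C(2) w comp_of_self[OF wV, of E] by blast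
    then have CH: "C \<subseteq> ?K w - HH (?K w)" using C(2) H[OF wV] by blast
    have eq: "E `` C \<inter> H = E `` C \<inter> HH (?K w)"
      using adj[OF wV] CK HV H[OF wV] by blast
    have "E `` C \<inter> HH (?K w) = {} \<or> (\<exists>v\<in>HH (?K w). E `` C \<inter> HH (?K w) \<subseteq> set (cc (?K w) v))"
      using HH[OF wV] C(1) CH unfolding elim_chains_def by simp
    then show "E `` C \<inter> H = {} \<or> (\<exists>v\<in>H. E `` C \<inter> H \<subseteq> set (c v))"
      unfolding eq using H[OF wV] c[OF wV] sub[OF wV] by (metis IntD1 subsetD)
  qed
  then show ?thesis by blast
qed

section \<open>The binomial bound for chains\<close>

text \<open>By \<open>pmodel_join\<close> the models of length \<open>m\<close> in \<open>K\<close>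
  pairwise intersect, so one path \<open>p\<close> meets them all. A linkage of size
  \<open>Suc m\<close> from \<open>p\<close> to \<open>S\<close> would give a forbidden model, so
  Menger's theorem yields a small separator. It hits each model, whose union is connected and meets
  both \<open>p\<close> and \<open>S\<close>.\<close>

lemma ex_small_hitting_set:
  assumes sym: "sym E" and fin: "finite E" "finite K" and K: "conn E K" and "0 < m"
    and no: "\<And>Bs. pmodel E S Bs \<Longrightarrow> length Bs = Suc m \<Longrightarrow> \<not> \<Union>(set Bs) \<subseteq> K"
  obtains X where "X \<subseteq> K" "card X \<le> m"
    "\<And>Bs. pmodel E S Bs \<Longrightarrow> length Bs = m \<Longrightarrow> \<not> \<Union>(set Bs) \<subseteq> K - X"
proof -
  define M where "M C \<longleftrightarrow> (\<exists>Bs. pmodel E S Bs \<and> length Bs = m \<and> \<Union>(set Bs) = C)" for C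
  obtain a where a: "a \<in> K" using conn_nonempty[OF K] by blast
  have "C \<inter> D \<noteq> {}" if "conn E C" "conn E D" "C \<subseteq> K" "D \<subseteq> K" "M C" "M D" for C D
  proof
    assume disj: "C \<inter> D = {}"
    obtain As where A: "pmodel E S As" "length As = m" "\<Union>(set As) = C"
      using \<open>M C\<close> unfolding M_def by blast
    obtain Bs where B: "pmodel E S Bs" "length Bs = m" "\<Union>(set Bs) = D"
      using \<open>M D\<close> unfolding M_def by blast
    obtain Cs where "pmodel E S Cs" "\<Union>(set Cs) \<subseteq> K" "length Cs = Suc m"
      by (rule pmodel_join[OF sym K A(1) _ B(1) _ _ A(2) B(2) \<open>0 < m\<close>])
        (use A(3) B(3) \<open>C \<subseteq> K\<close> \<open>D \<subseteq> K\<close> disj in simp_all)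
    then show False using no by blast
  qed
  then have "\<exists>p. p \<noteq> [] \<and> hd p = a \<and> distinct p \<and> set p \<subseteq> K \<and>
      successively (\<lambda>u v. (u, v) \<in> E) p \<and> (\<forall>C. conn E C \<longrightarrow> C \<subseteq> K - set p \<longrightarrow> \<not> M C)"
    by (intro ex_hitting_path sym fin(2) K a)
  then obtain p where p: "p \<noteq> []" "distinct p" "set p \<subseteq> K" "successively (\<lambda>u v. (u, v) \<in> E) p"
    and hit: "\<And>C. conn E C \<Longrightarrow> C \<subseteq> K - set p \<Longrightarrow> \<not> M C"
    by blast
  \<comment> \<open>With the edges restricted to \<open>K\<close>, connected sets that meet
    \<open>p\<close> stay in \<open>K\<close>, and so does the model built from a linkage.\<close>
  let ?E = "E \<inter> K \<times> K"
  have sym': "sym ?E" using sym unfolding sym_def by blast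
  have toE: "conn E C" if "conn ?E C" for C using conn_mono[OF that, of E] by blast
  have "\<not> linked ?E (set p) S (Suc m)"
  proof
    assume l: "linked ?E (set p) S (Suc m)"
    have "successively (\<lambda>u v. (u, v) \<in> ?E) p"
      by (rule successively_mono[OF p(4)]) (use p(3) in auto)
    moreover have "C \<subseteq> K" if "conn ?E C" "C \<inter> set p \<noteq> {}" for C
      using that p(3) by (intro conn_closedD[OF that(1), of K]) blast+
    ultimately obtain Bs where Bs: "pmodel ?E S Bs" "length Bs = Suc m" "\<Union>(set Bs) \<subseteq> K"
      using pmodel_of_linked[OF sym' p(2) _ l] by metis
    have "successively (adjacent E) Bs"
      using Bs(1) successively_mono[of "adjacent ?E" Bs "adjacent E"]
      unfolding pmodel_def adjacent_def by blast
    then have "pmodel E S Bs" using Bs(1) toE unfolding pmodel_def by blast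
    with no Bs show False by blast
  qed
  then obtain X where X: "finite X" "separates ?E (set p) S X" "card X < Suc m"
    using menger[of ?E "set p" S "Suc m"] fin(1) sym' by (metis finite_Int not_less)
  show ?thesis
  proof
    \<comment> \<open>The separator may contain vertices outside \<open>K\<close>; these are
      dropped.\<close>
    show "X \<inter> K \<subseteq> K" by blast
    have "card (X \<inter> K) \<le> card X" using X(1) by (intro card_mono) auto
    then show "card (X \<inter> K) \<le> m" using X(3) by simp
  next
    fix Bs assume Bs: "pmodel E S Bs" "length Bs = m"
    show "\<not> \<Union>(set Bs) \<subseteq> K - X \<inter> K"
    proof
      assume sub: "\<Union>(set Bs) \<subseteq> K - X \<inter> K"
      let ?U = "\<Union>(set Bs)"
      have "Bs \<noteq> []" using Bs(2) \<open>0 < m\<close> by auto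
      then have U: "conn E ?U" using conn_pmodel[OF sym Bs(1)] by blast
      then have "conn ?E ?U" by (rule conn_mono) (use sub in blast)
      moreover have "?U \<inter> S \<noteq> {}"
        using Bs(1) \<open>Bs \<noteq> []\<close> unfolding pmodel_def by (cases Bs) auto
      moreover have "?U \<inter> X = {}" using sub by blast
      ultimately have "?U \<inter> set p = {}" using X(2) unfolding separates_def by blast
      then have "?U \<subseteq> K - set p" using sub by blast
      then have "\<not> M ?U" using hit U by blast
      then show False using Bs unfolding M_def by blast
    qed
  qed
qed

text \<open>Induction on \<open>l\<close> for all \<open>V\<close> and \<open>S\<close>, with
  \<open>E\<close> fixed: in each component a hitting set \<open>X\<close> is stacked above the
  forest that the induction provides for the rest.\<close>

theorem ex_elim_chains:
  assumes "sym E" "finite E" "finite V" "S \<subseteq> V" "0 < l"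
    and "\<And>Bs. pmodel E S Bs \<Longrightarrow> length Bs = l \<Longrightarrow> \<not> \<Union>(set Bs) \<subseteq> V"
  shows "\<exists>H c. elim_chains E V S H c (l choose 2)"
  using assms(3-)
proof (induction l arbitrary: V S)
  case (Suc m)
  show ?case
  proof (cases "m = 0")
    case True
    \<comment> \<open>For \<open>l = 1\<close> a single vertex of \<open>S\<close> is already a
      model, and the empty forest meets the bound 0.\<close>
    have "S = {}"
    proof (rule ccontr)
      assume "S \<noteq> {}"
      then obtain s where "s \<in> S" by blast
      then show False
        using Suc.prems(4)[of "[{s}]"] Suc.prems(2) conn_singleton[of E s] True by auto
    qed
    then show ?thesis using elim_chains_empty by blast
  next
    case False
    show ?thesis
    proof (rule elim_chains_components[OF assms(1) Suc.prems(2)])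
      fix v assume v: "v \<in> V"
      let ?K = "comp_of E V v"
      have fin: "finite ?K" using finite_subset[OF comp_of_subset Suc.prems(1)] .
      have "\<not> \<Union>(set Bs) \<subseteq> ?K" if "pmodel E S Bs" "length Bs = Suc m" for Bs
        using Suc.prems(4)[OF that] comp_of_subset[of E V v] by blast
      then obtain X where X: "X \<subseteq> ?K" "card X \<le> m"
        and hit: "\<And>Bs. pmodel E S Bs \<Longrightarrow> length Bs = m \<Longrightarrow> \<not> \<Union>(set Bs) \<subseteq> ?K - X"
        using ex_small_hitting_set[OF assms(1,2) fin conn_comp_of[OF v], of m S] False by (metis neq0_conv)
      let ?S = "S \<inter> ?K - X"
      have "\<exists>H c. elim_chains E (?K - X) ?S H c (m choose 2)"
      proof (rule Suc.IH)
        fix Bs assume Bs: "pmodel E ?S Bs" "length Bs = m"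
        have "pmodel E S Bs" using Bs(1) unfolding pmodel_def by blast
        then show "\<not> \<Union>(set Bs) \<subseteq> ?K - X" using hit Bs(2) by blast
      qed (use fin False in auto)
      then obtain H c where "elim_chains E ?K (S \<inter> ?K) H c (card X + (m choose 2))"
        using elim_chains_Un[of X ?K E "S \<inter> ?K"] X(1) finite_subset[OF X(1) fin] by blast
      \<comment> \<open>Pascal's rule: \<open>Suc m choose 2 = m + (m choose 2)\<close>.\<close>
      moreover have "card X + (m choose 2) \<le> Suc m choose 2"
        using X(2) by (simp add: numeral_2_eq_2)
      ultimately show "\<exists>H c. elim_chains E ?K (S \<inter> ?K) H c (Suc m choose 2)"
        using elim_chains_mono by blast
    qed
  qed
qed simp

section \<open>Translation to digraphs\<close>

definition chain_system :: "'a set \<Rightarrow> ('a \<Rightarrow> 'a list) \<Rightarrow> bool" where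
  "chain_system H c \<longleftrightarrow> (\<forall>v\<in>H. c v \<noteq> [] \<and> last (c v) = v \<and> distinct (c v) \<and>
     set (c v) \<subseteq> H \<and> (\<forall>u\<in>set (c v). prefix (c u) (c v)))"

definition chain_forest :: "'a set \<Rightarrow> ('a \<Rightarrow> 'a list) \<Rightarrow> 'a pair_pre_digraph" where
  "chain_forest H c =
     \<lparr>pverts = H, parcs = {(u, v). u \<in> H \<and> v \<in> H \<and> c v = c u @ [v]}\<rparr>"

lemma chain_forest_simps [simp]:
  "pverts (chain_forest H c) = H"
  "(u, v) \<in> parcs (chain_forest H c) \<longleftrightarrow> u \<in> H \<and> v \<in> H \<and> c v = c u @ [v]"
  by (simp_all add: chain_forest_def)

lemma chain_systemD:
  assumes "chain_system H c" "v \<in> H"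
  shows "c v \<noteq> []" "last (c v) = v" "distinct (c v)" "set (c v) \<subseteq> H"
    "\<And>u. u \<in> set (c v) \<Longrightarrow> prefix (c u) (c v)" "v \<in> set (c v)"
  using assms last_in_set[of "c v"] unfolding chain_system_def by auto

text \<open>Both \<open>xs\<close> and the chain of its last vertex are prefixes of
  \<open>c v\<close> ending in the same vertex. As \<open>c v\<close> is distinct, they have the
  same length.\<close>

lemma chain_of_prefix:
  assumes "chain_system H c" "v \<in> H" "c v = xs @ ys" "xs \<noteq> []"
  shows "c (last xs) = xs"
proof -
  let ?u = "last xs"
  have u: "?u \<in> set (c v)" using assms(3,4) by simp
  then have uH: "?u \<in> H" using chain_systemD[OF assms(1,2)] by blast
  obtain zs where zs: "c v = c ?u @ zs"
    using chain_systemD(5)[OF assms(1,2) u] by (auto simp: prefix_def)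
  note cu = chain_systemD(1,2)[OF assms(1) uH]
  have pos: "0 < length xs" "0 < length (c ?u)" using assms(4) cu(1) by auto
  have "length xs - 1 < length (c v)" "length (c ?u) - 1 < length (c v)"
    using pos arg_cong[OF assms(3), of length] arg_cong[OF zs, of length]
    unfolding length_append by linarith+
  moreover have "c v ! (length xs - 1) = ?u"
    using assms(3,4) by (simp add: nth_append last_conv_nth)
  moreover have "c v ! (length (c ?u) - 1) = ?u"
    using zs cu by (simp add: nth_append last_conv_nth)
  ultimately have "length xs - 1 = length (c ?u) - 1"
    using chain_systemD(3)[OF assms(1,2)] by (metis nth_eq_iff_index_eq)
  then have "length xs = length (c ?u)"
    using assms(4) cu(1) by (metis Suc_diff_1 length_greater_0_conv)
  then show ?thesis using zs assms(3) by (metis append_eq_append_conv)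
qed

lemma chain_parent:
  assumes "chain_system H c" "v \<in> H" "c v \<noteq> [v]"
  obtains u where "u \<in> H" "c v = c u @ [v]"
proof -
  have v: "c v = butlast (c v) @ [v]"
    using chain_systemD(1,2)[OF assms(1,2)] by (metis append_butlast_last_id)
  then have ne: "butlast (c v) \<noteq> []" using assms(3) by (metis append_Nil)
  then have "c (last (butlast (c v))) = butlast (c v)"
    using chain_of_prefix[OF assms(1,2) v] by blast
  moreover have "last (butlast (c v)) \<in> H"
    using chain_systemD(4)[OF assms(1,2)] ne in_set_butlastD last_in_set by fast
  ultimately show ?thesis using that v by metis
qed

text \<open>Chain length grows along arcs, which excludes cycles, and a parent of \<open>v\<close>
  can only be the second to last entry of \<open>c v\<close>.\<close>

lemma rooted_forest_chain_forest:
  assumes "chain_system H c" "finite H"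
  shows "rooted_forest (chain_forest H c)"
proof -
  let ?F = "chain_forest H c"
  have "parcs ?F \<subseteq> H \<times> H" by auto
  then have "finite (parcs ?F)" using assms(2) by (meson finite_SigmaI finite_subset)
  then have "pair_fin_digraph ?F"
    using assms(2) by unfold_locales auto
  moreover have "parcs ?F \<subseteq> measure (\<lambda>v. length (c v))" by auto
  then have "acyclic (parcs ?F)" by (meson wf_acyclic wf_measure wf_subset)
  moreover have "in_degree ?F v \<le> 1" for v
  proof -
    have "in_arcs ?F v \<subseteq> {(last (butlast (c v)), v)}"
    proof
      fix e assume "e \<in> in_arcs ?F v"
      then obtain u where e: "e = (u, v)" "u \<in> H" "c v = c u @ [v]"
        unfolding in_arcs_def by (cases e) auto
      then have "last (butlast (c v)) = u" using chain_systemD(2)[OF assms(1)] by simp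
      with e show "e \<in> {(last (butlast (c v)), v)}" by simp
    qed
    then have "card (in_arcs ?F v) \<le> card {(last (butlast (c v)), v)}" by (intro card_mono) auto
    then show ?thesis unfolding in_degree_def by simp
  qed
  ultimately show ?thesis unfolding rooted_forest_def by blast
qed

lemma chain_forest_reachable:
  assumes "chain_system H c" "v \<in> H" "u \<in> set (c v)"
  shows "u \<rightarrow>\<^sup>*\<^bsub>chain_forest H c\<^esub> v"
proof -
  interpret F: pair_wf_digraph "chain_forest H c" by unfold_locales auto
  show ?thesis
    using assms(2,3)
  proof (induction "length (c v)" arbitrary: v rule: less_induct)
    case less
    show ?case
    proof (cases "u = v")
      case True
      then show ?thesis using less.prems by simp
    next
      case False
      then have "c v \<noteq> [v]" using less.prems(2) by auto
      then obtain p where p: "p \<in> H" "c v = c p @ [v]"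
        using chain_parent[OF assms(1) less.prems(1)] by blast
      then have "u \<in> set (c p)" using less.prems(2) False by auto
      with less.hyps[of p] p have "u \<rightarrow>\<^sup>*\<^bsub>chain_forest H c\<^esub> p" by simp
      moreover have "(p, v) \<in> parcs (chain_forest H c)" using p less.prems(1) by simp
      ultimately show ?thesis by (rule F.reachable_adj_trans)
    qed
  qed
qed

lemma root_chain_iff:
  assumes "chain_system H c" "finite H" "v \<in> H"
  shows "in_degree (chain_forest H c) v = 0 \<longleftrightarrow> c v = [v]"
proof -
  let ?F = "chain_forest H c"
  have "in_arcs ?F v \<subseteq> H \<times> H" unfolding in_arcs_def by auto
  then have "finite (in_arcs ?F v)" using assms(2) by (meson finite_SigmaI finite_subset)
  then have "in_degree ?F v = 0 \<longleftrightarrow> in_arcs ?F v = {}" unfolding in_degree_def by simp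
  also have "\<dots> \<longleftrightarrow> (\<forall>u\<in>H. c v \<noteq> c u @ [v])"
    using assms(3) unfolding in_arcs_def by auto
  also have "\<dots> \<longleftrightarrow> c v = [v]"
  proof
    assume "\<forall>u\<in>H. c v \<noteq> c u @ [v]"
    then show "c v = [v]" using chain_parent[OF assms(1,3)] by metis
  next
    assume "c v = [v]"
    then show "\<forall>u\<in>H. c v \<noteq> c u @ [v]" using chain_systemD(1)[OF assms(1)] by auto
  qed
  finally show ?thesis .
qed

text \<open>Along the path each chain extends the previous one by the next vertex, starting from the
  singleton chain of a root. Bounds on chains thus bound the vertex-height.\<close>

lemma root_to_leaf_path_chain:
  assumes "chain_system H c" "finite H" "root_to_leaf_path (chain_forest H c) p"
  shows "last p \<in> H" "c (last p) = p"
proof -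
  let ?F = "chain_forest H c"
  have p: "set p \<subseteq> H" "set (vwalk_arcs p) \<subseteq> parcs ?F" "p \<noteq> []" "in_degree ?F (hd p) = 0"
    using assms(3) unfolding root_to_leaf_path_def vpath_def vwalk_def by auto
  then show "last p \<in> H" by auto
  have "hd p \<in> H" using p(1,3) by auto
  then have "c (hd p) = [hd p]" using root_chain_iff[OF assms(1,2)] p(4) by blast
  with p(3,2) show "c (last p) = p"
  proof (induction p rule: rev_nonempty_induct)
    case (snoc x xs)
    then have "set (vwalk_arcs xs) \<subseteq> parcs ?F" "(last xs, x) \<in> parcs ?F"
      by (auto simp: set_vwalk_arcs_snoc)
    then show ?case using snoc by simp
  qed simp
qed

lemma vertex_height_chain_forest_le:
  assumes "chain_system H c" "finite H" "\<And>v. v \<in> H \<Longrightarrow> length (c v) \<le> h"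
  shows "vertex_height (chain_forest H c) \<le> h"
proof -
  let ?P = "{p. root_to_leaf_path (chain_forest H c) p}"
  have "length p \<le> h" if "p \<in> ?P" for p
    using root_to_leaf_path_chain[OF assms(1,2), of p] assms(3)[of "last p"] that by simp
  then have "insert 0 (length ` ?P) \<subseteq> {..h}" by auto
  moreover from this have "finite (insert 0 (length ` ?P))" by (rule finite_subset) simp
  ultimately show ?thesis
    unfolding vertex_height_def by (metis Max_in atMost_iff insert_not_empty subsetD)
qed

lemma vwalk_arcs_chain:
  assumes "chain_system H c" "v \<in> H" "prefix xs (c v)"
  shows "set (vwalk_arcs xs) \<subseteq> parcs (chain_forest H c)"
  using assms(3)
proof (induction xs rule: rev_induct)
  case (snoc x xs)
  show ?case
  proof (cases "xs = []")
    case False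
    obtain ys where ys: "c v = (xs @ [x]) @ ys" using snoc.prems by (auto simp: prefix_def)
    then have "c v = xs @ ([x] @ ys)" by simp
    then have "c (last xs) = xs" using chain_of_prefix[OF assms(1,2)] False by blast
    moreover have "c x = xs @ [x]" using chain_of_prefix[OF assms(1,2) ys] by simp
    moreover have "last xs \<in> H" "x \<in> H"
      using chain_systemD(4)[OF assms(1,2)] ys False by auto
    ultimately have "(last xs, x) \<in> parcs (chain_forest H c)" by simp
    moreover have "prefix xs (c v)" using ys by simp
    ultimately show ?thesis using snoc.IH False by (simp add: set_vwalk_arcs_snoc)
  qed simp
qed simp

text \<open>A longest chain extending \<open>c v\<close> ends in a leaf, since a child of its last
  vertex would have a longer one.\<close>

lemma ex_root_to_leaf_path:
  assumes "chain_system H c" "finite H" "v \<in> H"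
  obtains p where "root_to_leaf_path (chain_forest H c) p" "set (c v) \<subseteq> set p"
proof -
  let ?F = "chain_forest H c"
  let ?W = "{w \<in> H. prefix (c v) (c w)}"
  have fin: "finite ?W" and "?W \<noteq> {}" using assms(2,3) by auto
  then obtain w where w: "w \<in> ?W" and w_max: "(MAX x\<in>?W. length (c x)) = length (c w)"
    by (rule obtains_MAX)
  have max: "length (c x) \<le> length (c w)" if "x \<in> ?W" for x
    unfolding w_max[symmetric] using fin that by (intro Max_ge) auto
  from w have wH: "w \<in> H" and pre: "prefix (c v) (c w)" by auto
  note cw = chain_systemD[OF assms(1) wH]
  have "c w = [hd (c w)] @ tl (c w)" using cw(1) by simp
  from chain_of_prefix[OF assms(1) wH this] have "c (hd (c w)) = [hd (c w)]" by simp
  moreover have "hd (c w) \<in> H" using hd_in_set[OF cw(1)] cw(4) by (rule rev_subsetD)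
  ultimately have "in_degree ?F (hd (c w)) = 0" using root_chain_iff[OF assms(1,2)] by blast
  moreover have "out_arcs ?F w = {}"
  proof (rule ccontr)
    assume "out_arcs ?F w \<noteq> {}"
    then obtain x where x: "x \<in> H" "c x = c w @ [x]" unfolding out_arcs_def by auto
    then have "x \<in> ?W" using pre by (simp add: prefix_prefix)
    with max[of x] x(2) show False by simp
  qed
  then have "out_degree ?F (last (c w)) = 0" using cw(2) unfolding out_degree_def by simp
  moreover have "vpath (c w) ?F"
    using cw vwalk_arcs_chain[OF assms(1) wH, of "c w"] unfolding vpath_def vwalk_def by simp
  ultimately have "root_to_leaf_path ?F (c w)" unfolding root_to_leaf_path_def by blast
  moreover have "set (c v) \<subseteq> set (c w)" using pre by (rule set_mono_prefix)
  ultimately show ?thesis by (rule that)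
qed

section \<open>Connectedness and components in digraphs\<close>

lemma connected_induce:
  assumes "pair_graph G" "conn (parcs G) B" "B \<subseteq> pverts G"
  shows "connected (G \<restriction> B)"
proof -
  interpret G: pair_graph G by fact
  have wf: "wf_digraph (G \<restriction> B)" by unfold_locales auto
  interpret M: pair_wf_digraph "mk_symmetric (G \<restriction> B)"
    using wf by (rule wf_digraph.wellformed_mk_symmetric)
  have arc: "(u, v) \<in> parcs (mk_symmetric (G \<restriction> B))" if "u \<in> B" "v \<in> B" "(u, v) \<in> parcs G" for u v
    using that by (force simp: parcs_mk_symmetric)
  have "u \<rightarrow>\<^sup>*\<^bsub>mk_symmetric (G \<restriction> B)\<^esub> v" if "u \<in> B" "v \<in> B" for u v
  proof -
    have "B \<subseteq> {w. u \<rightarrow>\<^sup>*\<^bsub>mk_symmetric (G \<restriction> B)\<^esub> w}"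
    proof (rule conn_closedD[OF assms(2)])
      have "u \<rightarrow>\<^sup>*\<^bsub>mk_symmetric (G \<restriction> B)\<^esub> u" using that(1) by simp
      then show "{w. u \<rightarrow>\<^sup>*\<^bsub>mk_symmetric (G \<restriction> B)\<^esub> w} \<inter> B \<noteq> {}" using that(1) by blast
    next
      fix w x assume "w \<in> {w. u \<rightarrow>\<^sup>*\<^bsub>mk_symmetric (G \<restriction> B)\<^esub> w}" "w \<in> B" "x \<in> B" "(w, x) \<in> parcs G"
      then show "x \<in> {w. u \<rightarrow>\<^sup>*\<^bsub>mk_symmetric (G \<restriction> B)\<^esub> w}"
        using M.reachable_adj_trans[OF _ arc] by blast
    qed
    then show ?thesis using that(2) by blast
  qed
  then show ?thesis
    using conn_nonempty[OF assms(2)] unfolding connected_def strongly_connected_def by simp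
qed

text \<open>\<open>C\<close> need not be induced, but its symmetrised arcs are arcs of
  \<open>G\<close>. So a set closed under the edges of \<open>G\<close> within
  \<open>verts C\<close> contains everything reachable from it in \<open>C\<close>.\<close>

lemma conn_verts_connected:
  assumes "pair_graph G" "subgraph C (with_proj G \<restriction> W)" "connected C"
  shows "conn (parcs G) (verts C)"
proof (rule connI)
  show "verts C \<noteq> {}" using assms(3) unfolding connected_def strongly_connected_def by simp
next
  interpret G: pair_graph G by fact
  fix D w assume D: "D \<subseteq> verts C" "w \<in> D"
    and closed: "\<And>u v. u \<in> D \<Longrightarrow> v \<in> verts C \<Longrightarrow> (u, v) \<in> parcs G \<Longrightarrow> v \<in> D"
  have wfC: "wf_digraph C" and sub: "arcs C \<subseteq> parcs G" and C: "tail C = fst" "head C = snd"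
    using assms(2) by (auto simp: subgraph_def compatible_def)
  interpret M: pair_wf_digraph "mk_symmetric C"
    using wfC by (rule wf_digraph.wellformed_mk_symmetric)
  show "verts C \<subseteq> D"
  proof
    fix x assume "x \<in> verts C"
    then have "w \<rightarrow>\<^sup>*\<^bsub>mk_symmetric C\<^esub> x"
      using assms(3) D unfolding connected_def strongly_connected_def by auto
    then show "x \<in> D"
    proof (induction rule: M.reachable_induct)
      case base
      show ?case by (fact D(2))
    next
      case (step x y)
      then have xy: "(x, y) \<in> parcs (mk_symmetric C)" by simp
      then have "(x, y) \<in> parcs G"
        using sub C G.arcs_symmetric by (auto simp: parcs_mk_symmetric)
      moreover have "y \<in> verts C" using M.in_arcsD2[OF xy] by simp
      ultimately show ?case using closed step.IH by blast
    qed
  qed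
qed

text \<open>A neighbour in \<open>W\<close> could be added to the component: \<open>G\<close>
  induces a larger connected subgraph, against maximality. For \<open>W\<close> the complement of
  \<open>H\<close>, all neighbours lie in \<open>H\<close>, as the restriction to \<open>H\<close>
  in \<open>elim_chains\<close> requires.\<close>

lemma neighbours_component:
  assumes "pair_graph G" "component C (with_proj G \<restriction> W)" "W \<subseteq> pverts G"
  shows "neighbours G (verts C) \<inter> W = {}"
proof (rule ccontr)
  interpret G: pair_graph G by fact
  let ?GW = "with_proj G \<restriction> W"
  have C: "subgraph C ?GW" "connected C"
    and max: "\<And>H'. H' \<noteq> C \<Longrightarrow> subgraph C H' \<Longrightarrow> subgraph H' ?GW \<Longrightarrow> \<not> connected H'"
    using assms(2) unfolding component_def pre_digraph.max_subgraph_def by auto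
  assume "neighbours G (verts C) \<inter> W \<noteq> {}"
  then obtain u v where uv: "v \<in> W" "v \<notin> verts C" "u \<in> verts C" "(u, v) \<in> parcs G"
    unfolding neighbours_def by blast
  let ?B = "insert v (verts C)"
  have CW: "verts C \<subseteq> W" using C(1) unfolding subgraph_def by simp
  have "sym (parcs G)" using G.arcs_symmetric by (auto intro: symI)
  then have "conn (parcs G) ?B"
    using conn_insert[OF _ conn_verts_connected[OF assms(1) C] uv(3,4)] by blast
  then have "connected (G \<restriction> ?B)"
    using connected_induce[OF assms(1)] CW uv(1) assms(3) by blast
  moreover have "subgraph C (G \<restriction> ?B)"
  proof -
    have wfC: "wf_digraph C" and CG: "arcs C \<subseteq> parcs G" "tail C = fst" "head C = snd"
      using C(1) by (auto simp: subgraph_def compatible_def)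
    have "arcs C \<subseteq> arcs (G \<restriction> ?B)"
      using CG wf_digraph.tail_in_verts[OF wfC] wf_digraph.head_in_verts[OF wfC] by auto
    moreover have "wf_digraph (G \<restriction> ?B)" by unfold_locales auto
    ultimately show ?thesis using wfC CG(2,3) by (auto simp: subgraph_def compatible_def)
  qed
  moreover have "subgraph (G \<restriction> ?B) ?GW"
  proof -
    have "wf_digraph (G \<restriction> ?B)" "wf_digraph ?GW" by (unfold_locales, auto)+
    then show ?thesis using CW uv(1) by (auto simp: subgraph_def compatible_def)
  qed
  moreover have "(G \<restriction> ?B) \<noteq> C"
  proof
    assume "(G \<restriction> ?B) = C"
    then have "verts C = ?B" by (metis induce_subgraph_verts)
    then show False using uv(2) by blast
  qed
  ultimately show False using max by blast
qed

lemma wf_digraph_forest_closure: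
  assumes "pair_wf_digraph F"
  shows "wf_digraph (forest_closure F)"
proof -
  interpret F: pair_wf_digraph F by fact
  have "fst e \<in> pverts F \<and> snd e \<in> pverts F" if e: "e \<in> parcs (forest_closure F)" for e
  proof -
    obtain u v where uv: "e = (u, v)" by (cases e)
    then consider "u \<rightarrow>\<^sup>*\<^bsub>F\<^esub> v" | "v \<rightarrow>\<^sup>*\<^bsub>F\<^esub> u"
      using e by (auto simp: forest_closure_def)
    then show ?thesis
      by cases (simp_all add: uv F.reachable_in_verts)
  qed
  then show ?thesis by unfold_locales (simp_all add: forest_closure_def)
qed

text \<open>The witness is the subgraph induced by \<open>H\<close>. Membership in a chain yields
  ancestry in the forest, and a chain holding the neighbours of a component extends to a
  root-to-leaf path.\<close>

lemma rel_elimination_forest_chain_forest: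
  assumes G: "pair_graph G" and ec: "elim_chains (parcs G) (pverts G) S H c h"
  shows "rel_elimination_forest (chain_forest H c) G S" "vertex_height (chain_forest H c) \<le> h"
proof -
  interpret G: pair_graph G by fact
  let ?F = "chain_forest H c"
  have sub: "S \<subseteq> H" "H \<subseteq> pverts G" and cs: "chain_system H c"
    and len: "\<And>v. v \<in> H \<Longrightarrow> length (c v) \<le> h"
    and edge: "\<And>u v. u \<in> H \<Longrightarrow> v \<in> H \<Longrightarrow> (u, v) \<in> parcs G \<Longrightarrow> u \<in> set (c v) \<or> v \<in> set (c u)"
    and nb: "\<And>C. conn (parcs G) C \<Longrightarrow> C \<subseteq> pverts G - H \<Longrightarrow>
      parcs G `` C \<inter> H = {} \<or> (\<exists>v\<in>H. parcs G `` C \<inter> H \<subseteq> set (c v))"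
    using ec unfolding elim_chains_def chain_system_def by simp_all
  have fin: "finite H" using sub(2) G.pair_finite_verts by (rule finite_subset)
  interpret F: pair_wf_digraph ?F by unfold_locales auto
  show "vertex_height ?F \<le> h" using vertex_height_chain_forest_le[OF cs fin len] .
  let ?H = "with_proj G \<restriction> H"
  have wfH: "wf_digraph ?H" by unfold_locales auto
  then have "induced_subgraph ?H G"
    using sub(2) G.wf_digraph by (simp add: induced_subgraph_def subgraph_def compatible_def)
  moreover have "elimination_forest ?F ?H"
  proof -
    have wf_closure: "wf_digraph (forest_closure ?F)"
      using F.pair_wf_digraph_axioms by (rule wf_digraph_forest_closure)
    have "(u, v) \<in> parcs (forest_closure ?F)" if "(u, v) \<in> arcs ?H" for u v
    proof -
      have uv: "u \<in> H" "v \<in> H" "(u, v) \<in> parcs G" using that by auto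
      then have "u \<noteq> v" using G.no_loops' by blast
      then show ?thesis
        using edge[OF uv] chain_forest_reachable[OF cs] uv unfolding forest_closure_def by auto
    qed
    then have "arcs ?H \<subseteq> parcs (forest_closure ?F)" by (rule subrelI)
    moreover have "verts ?H \<subseteq> pverts (forest_closure ?F)" by (simp add: forest_closure_def)
    ultimately have "subgraph ?H (forest_closure ?F)"
      using wfH wf_closure by (simp add: subgraph_def compatible_def)
    then show ?thesis
      unfolding elimination_forest_def using rooted_forest_chain_forest[OF cs fin] by simp
  qed
  moreover have "neighbours G (verts C) = {} \<or>
      (\<exists>p. root_to_leaf_path ?F p \<and> neighbours G (verts C) \<subseteq> set p)"
    if C: "component C (G \<restriction> (pverts G - H))" for C
  proof -
    have subC: "subgraph C (G \<restriction> (pverts G - H))" "connected C"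
      using C unfolding component_def pre_digraph.max_subgraph_def by auto
    have "conn (parcs G) (verts C)" using conn_verts_connected[OF G subC] .
    moreover have "verts C \<subseteq> pverts G - H" using subC(1) unfolding subgraph_def by simp
    ultimately have *: "parcs G `` verts C \<inter> H = {} \<or>
        (\<exists>v\<in>H. parcs G `` verts C \<inter> H \<subseteq> set (c v))" by (rule nb)
    have "neighbours G (verts C) \<subseteq> parcs G `` verts C \<inter> H"
      using neighbours_component[OF G C] unfolding neighbours_def by blast
    with * show ?thesis
      using ex_root_to_leaf_path[OF cs fin] by (metis order_trans subset_empty)
  qed
  ultimately show "rel_elimination_forest ?F G S"
    unfolding rel_elimination_forest_def using sub(1) by (intro exI[of _ ?H]) auto
qed

section \<open>Path models in digraphs and the final bound\<close>

lemma rooted_model_of_pmodel: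
  assumes G: "pair_graph G" and Bs: "pmodel (parcs G) S Bs" "length Bs = l" "\<Union>(set Bs) \<subseteq> pverts G"
  shows "is_rooted_model (path_graph l) G S (\<lambda>i. Bs ! i)"
proof -
  interpret G: pair_graph G by fact
  have B: "\<And>B. B \<in> set Bs \<Longrightarrow> conn (parcs G) B \<and> B \<inter> S \<noteq> {}"
    and disj: "sorted_wrt disjnt Bs" and adj: "successively (adjacent (parcs G)) Bs"
    using Bs(1) unfolding pmodel_def by auto
  have step: "\<exists>u\<in>Bs ! i. \<exists>v\<in>Bs ! Suc i. (u, v) \<in> parcs G" if "Suc i < l" for i
    using adj that Bs(2) unfolding successively_conv_nth adjacent_def by blast
  have "disjoint_family_on (\<lambda>i. Bs ! i) {..<l}"
    using disj Bs(2) unfolding disjoint_family_on_def sorted_wrt_iff_nth_less disjnt_def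
    by (metis Int_commute lessThan_iff linorder_neqE_nat)
  \<comment> \<open>\<open>path_graph\<close> has every edge in both directions; the backward arcs
    are covered by the symmetry of \<open>G\<close>.\<close>
  moreover have "\<exists>u\<in>Bs ! i. \<exists>v\<in>Bs ! j. (u, v) \<in> parcs G" if "(i, j) \<in> parcs (path_graph l)" for i j
    using that step[of i] step[of j] G.arcs_symmetric unfolding path_graph_def by auto
  moreover have "Bs ! i \<subseteq> pverts G \<and> connected (G \<restriction> Bs ! i) \<and> Bs ! i \<inter> S \<noteq> {}"
    if "i \<in> pverts (path_graph l)" for i
  proof -
    have "Bs ! i \<in> set Bs" using that Bs(2) by (simp add: path_graph_def)
    then show ?thesis using B connected_induce[OF G] Bs(3) by blast
  qed
  ultimately show ?thesis
    unfolding is_rooted_model_def is_model_def by (auto simp: path_graph_def)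
qed

theorem theorem3p1:
  fixes G :: "'a pair_pre_digraph" and S :: "'a set" and l :: nat
  assumes "0 < l"
    and "pair_graph G"
    and "S \<subseteq> pverts G"
    and "\<not> (\<exists>B. is_rooted_model (path_graph l) G S B)"
  shows "td G S \<le> l choose 2"
proof -
  interpret G: pair_graph G by fact
  have "sym (parcs G)" using G.arcs_symmetric by (auto intro: symI)
  moreover have "\<not> \<Union>(set Bs) \<subseteq> pverts G" if "pmodel (parcs G) S Bs" "length Bs = l" for Bs
    using rooted_model_of_pmodel[OF assms(2) that] assms(4) by blast
  ultimately obtain H c where "elim_chains (parcs G) (pverts G) S H c (l choose 2)"
    using ex_elim_chains[of "parcs G" "pverts G" S l] G.pair_finite_arcs G.pair_finite_verts assms(1,3)
    by blast
  note F = rel_elimination_forest_chain_forest[OF assms(2) this]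
  have "td G S \<le> vertex_height (chain_forest H c)"
    unfolding td_def using F(1) by (intro Least_le) blast
  then show ?thesis using F(2) by simp
qed

end
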